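(* Let $D>0$ be a discriminant, let $f_D=\sum_n a_{f_D}(n)q^n$ be the unique weakly holomorphic modular form in $M^!_{-1/2}$ with $f_D=q^{-D}+O(1)$, and let $\Phi(f_D,z)$ be its regularized theta lift. Let $\widetilde\theta$ be a harmonic Maass form of weight $3/2$ for $\Gamma_0(4)$ with $\xi_{3/2}\widetilde\theta=\theta$, where $\theta(\tau)=\sum_{n\in\mathbb{Z}}q^{n^2}$. Then the special value of $\Phi(f_D,z)$ at $z=i$ is given by $$\Phi(f_{D},i) = \frac{1}{2}\sum_{d \in \mathbb{Z}}a_{f_{D}}(-d)\sum_{\substack{x,y \in \mathbb{Z} \\ x \equiv d\, (2)}}a_{\widetilde{\theta}}^{+}(d-x^{2}-y^{2}),$$ where $a_{f_D}(-d)$ and $a_{\widetilde{\theta}}^{+}(d)$ denote the coefficients of $f_D$ and of the holomorphic part of $\widetilde{\theta}$, respectively.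
   Context: $\mathbb{H}$ is the complex upper half-plane, $\tau=u+iv\in\mathbb{H}$, $q=e^{2\pi i\tau}$, $e(x)=e^{2\pi i x}$. A discriminant $D>0$ is a positive integer with $D\equiv 0,1 \pmod 4$ (squares allowed). $M^!_{-1/2}$ is the space of weakly holomorphic modular forms $f=\sum_{n\gg-\infty}a_f(n)q^n$ of weight $-1/2$ for $\Gamma_0(4)$ satisfying the Kohnen plus space condition $a_f(n)=0$ for $n\equiv 1,2\pmod 4$. For every discriminant $D>0$ there is a unique $f_D\in M^!_{-1/2}$ with $f_D=q^{-D}+O(1)$, where $O(1)$ denotes a power series in nonnegative powers of $q$. Harmonic Maass forms of weight $3/2$ for $\Gamma_0(4)$ are smooth functions on $\mathbb{H}$ transforming like modular forms of weight $3/2$ for $\Gamma_0(4)$ (with the usual theta multiplier), annihilated by $\Delta_{3/2}$, where $\Delta_k=-v^2(\partial_u^2+\partial_v^2)+ikv(\partial_u+i\partial_v)$, and of at most linear exponential growth at the cusps. The operator $\xi_{k}$ is given by $\xi_kg=2iv^k\,\overline{\partial g/\partial\overline\tau}$. A form $\widetilde\theta$ with $\xi_{3/2}\widetilde\theta=\theta$ has a Fourier expansion $\widetilde\theta=\widetilde\theta^++\widetilde\theta^-$ with holomorphic part $\widetilde\theta^+=\sum_{n\gg-\infty}a^+_{\widetilde\theta}(n)q^n$ and non-holomorphic part $\widetilde\theta^-=a^-(0)v^{-1/2}+\sum_{n<0}a^-(n)\Gamma(-1/2,4\pi|n|v)q^n$, where $\Gamma(s,x)=\int_x^\infty e^{-t}t^{s-1}dt$.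 Theta lift: let $L=\mathbb{Z}^3$ with $Q(a,b,c)=-b^2+ac$, an even lattice of signature $(1,2)$, with dual lattice $L'=\{(a,b/2,c):a,b,c\in\mathbb{Z}\}$ and $L'/L\cong\mathbb{Z}/2\mathbb{Z}$ via $b \bmod 2$. The Grassmannian of positive lines in $L\otimes\mathbb{R}$ is identified with $\mathbb{H}$ so that for $z=x+iy\in\mathbb{H}$ and $\lambda=(a,b/2,c)\in L'$ the projections $\lambda_z$, $\lambda_{z^\perp}$ of $\lambda$ to the line $z$ and to its orthogonal complement satisfy $$Q(\lambda_z)=\frac{1}{4y^2}\big(a|z|^2+bx+c\big)^2,\qquad Q(\lambda_{z^\perp})=-\frac{1}{4y^2}|az^2+bz+c|^2.$$ For $h\in\{0,1\}$ put $$\Theta_h(\tau,z)=v\sum_{\substack{\lambda=(a,b/2,c)\in L'\\ b\equiv h\,(2)}}e\big(Q(\lambda_z)\tau+Q(\lambda_{z^\perp})\overline{\tau}\big).$$ For $f\in M^!_{-1/2}$ write $f(\tau)=f_0(4\tau)+f_1(4\tau)$ with $f_0(\tau)=\sum_{n\equiv 0(4)}a_f(n)q^{n/4}$ and $f_1(\tau)=\sum_{n\equiv 3(4)}a_f(n)q^{n/4}$. The regularized theta lift is $$\Phi(f,z)=\lim_{T\to\infty}\int_{\mathcal{F}_T}\Big(f_0(\tau)\overline{\Theta_0(\tau,z)}+f_1(\tau)\overline{\Theta_1(\tau,z)}\Big)v^{-1/2}\frac{du\,dv}{v^2},$$ where $\mathcal{F}_T=\{\tau\in\mathbb{H}:|u|\le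 1/2,\ |\tau|\ge 1,\ v\le T\}$.
   Formalization: The holomorphic part of θ̃ is additionally required to satisfy the Kohnen plus condition (coefficients vanish for n≡1,2 mod 4); without it the formula fails, since replacing θ̃ by θ̃+θ³ changes the right-hand side by 6 for D=1. *)

theory Defs
  imports "HOL-Analysis.Analysis"
begin

definition uhp :: "complex set" where
  "uhp = {\<tau>. Im \<tau> > 0}"

definition e :: "complex \<Rightarrow> complex" where
  "e x = exp (2 * of_real pi * \<i> * x)"

definition moebius :: "int \<Rightarrow> int \<Rightarrow> int \<Rightarrow> int \<Rightarrow> complex \<Rightarrow> complex" where
  "moebius a b c d \<tau> = (of_int a * \<tau> + of_int b) / (of_int c * \<tau> + of_int d)"

definition theta :: "complex \<Rightarrow> complex" where
  "theta \<tau> = (\<Sum>\<^sub>\<infinity>n::int. e (of_int (n\<^sup>2) * \<tau>))"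


section \<open>Modular forms of half-integral weight for \<open>\<Gamma>\<^sub>0(4)\<close>\<close>

text \<open>
  Half-integral weights are given by the odd integer \<open>m\<close>, the weight being \<open>m/2\<close>. The factor
  of automorphy is the \<open>m\<close>-th power of \<open>\<theta>(\<gamma>\<tau>)/\<theta>(\<tau>)\<close>, which is the usual theta
  multiplier times \<open>(c\<tau> + d)\<^sup>1\<^sup>/\<^sup>2\<close>; recall that \<open>\<theta>\<close> has no zeros in the upper half-plane.
\<close>

definition modular_Gamma0_4 :: "int \<Rightarrow> (complex \<Rightarrow> complex) \<Rightarrow> bool" where
  "modular_Gamma0_4 m f \<longleftrightarrow>
     (\<forall>a b c d :: int. a * d - b * c = 1 \<longrightarrow> 4 dvd c \<longrightarrow>
        (\<forall>\<tau>\<in>uhp. f (moebius a b c d \<tau>)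
                  = (theta (moebius a b c d \<tau>) / theta \<tau>) powi m * f \<tau>))"

text \<open>
  At most linear exponential growth at all cusps: \<open>(c\<tau> + d)\<^sup>-\<^sup>m\<^sup>/\<^sup>2 f(\<gamma>\<tau>) = O(e\<^sup>C\<^sup>v)\<close> for every
  \<open>\<gamma>\<close> in \<open>SL\<^sub>2(\<int>)\<close>. Only absolute values enter, so no branch of the root has to be chosen.
  For holomorphic modular \<open>f\<close> this says that \<open>f\<close> is meromorphic at the cusps.
\<close>

definition linear_exp_growth :: "int \<Rightarrow> (complex \<Rightarrow> complex) \<Rightarrow> bool" where
  "linear_exp_growth m f \<longleftrightarrow>
     (\<forall>a b c d :: int. a * d - b * c = 1 \<longrightarrow>
        (\<exists>A C :: real. \<forall>\<tau>. Im \<tau> \<ge> 1 \<longrightarrow>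
           norm (of_int c * \<tau> + of_int d) powr (- of_int m / 2) * norm (f (moebius a b c d \<tau>))
             \<le> A * exp (C * Im \<tau>)))"

definition weakly_holomorphic :: "int \<Rightarrow> (complex \<Rightarrow> complex) \<Rightarrow> bool" where
  "weakly_holomorphic m f \<longleftrightarrow>
     f holomorphic_on uhp \<and> modular_Gamma0_4 m f \<and> linear_exp_growth m f"

definition q_expansion :: "(complex \<Rightarrow> complex) \<Rightarrow> (int \<Rightarrow> complex) \<Rightarrow> bool" where
  "q_expansion f a \<longleftrightarrow>
     (\<exists>N. \<forall>n<N. a n = 0) \<and>
     (\<forall>\<tau>\<in>uhp. ((\<lambda>n. a n * e (of_int n * \<tau>)) has_sum f \<tau>) UNIV)"

definition q_coeff :: "(complex \<Rightarrow> complex) \<Rightarrow> int \<Rightarrow> complex" where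
  "q_coeff f = (THE a. q_expansion f a)"

text \<open>The Kohnen plus space condition in weights \<open>-1/2\<close> and \<open>3/2\<close>.\<close>

definition kohnen_plus :: "(int \<Rightarrow> complex) \<Rightarrow> bool" where
  "kohnen_plus a \<longleftrightarrow> (\<forall>n. n mod 4 \<in> {1, 2} \<longrightarrow> a n = 0)"

definition M_shriek_minus_half :: "(complex \<Rightarrow> complex) set" where
  "M_shriek_minus_half =
     {f. weakly_holomorphic (-1) f \<and> (\<exists>a. q_expansion f a \<and> kohnen_plus a)}"


section \<open>Harmonic Maass forms\<close>

definition d_u :: "(complex \<Rightarrow> complex) \<Rightarrow> complex \<Rightarrow> complex" where
  "d_u g \<tau> = vector_derivative (\<lambda>t::real. g (\<tau> + of_real t)) (at 0)"

definition d_v :: "(complex \<Rightarrow> complex) \<Rightarrow> complex \<Rightarrow> complex" where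
  "d_v g \<tau> = vector_derivative (\<lambda>t::real. g (\<tau> + \<i> * of_real t)) (at 0)"

definition d_taubar :: "(complex \<Rightarrow> complex) \<Rightarrow> complex \<Rightarrow> complex" where
  "d_taubar g \<tau> = (d_u g \<tau> + \<i> * d_v g \<tau>) / 2"

text \<open>Smoothness in the real sense; \<open>differentiable_on\<close> is real Frechet differentiability.\<close>

definition smooth_uhp :: "(complex \<Rightarrow> complex) \<Rightarrow> bool" where
  "smooth_uhp g \<longleftrightarrow> (\<forall>j k. (d_u ^^ j) ((d_v ^^ k) g) differentiable_on uhp)"

definition hyperbolic_Laplacian :: "real \<Rightarrow> (complex \<Rightarrow> complex) \<Rightarrow> complex \<Rightarrow> complex" where
  "hyperbolic_Laplacian k g \<tau> =
     - of_real ((Im \<tau>)\<^sup>2) * (d_u (d_u g) \<tau> + d_v (d_v g) \<tau>)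
     + \<i> * of_real (k * Im \<tau>) * (d_u g \<tau> + \<i> * d_v g \<tau>)"

definition xi :: "real \<Rightarrow> (complex \<Rightarrow> complex) \<Rightarrow> complex \<Rightarrow> complex" where
  "xi k g \<tau> = 2 * \<i> * of_real (Im \<tau> powr k) * cnj (d_taubar g \<tau>)"

definition harmonic_Maass_form :: "int \<Rightarrow> (complex \<Rightarrow> complex) \<Rightarrow> bool" where
  "harmonic_Maass_form m g \<longleftrightarrow>
     smooth_uhp g \<and> modular_Gamma0_4 m g \<and>
     (\<forall>\<tau>\<in>uhp. hyperbolic_Laplacian (of_int m / 2) g \<tau> = 0) \<and>
     linear_exp_growth m g"

definition upper_Gamma :: "real \<Rightarrow> real \<Rightarrow> real" where
  "upper_Gamma s x = integral {x..} (\<lambda>t. exp (- t) * t powr (s - 1))"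

text \<open>
  The Fourier expansion, in weight \<open>3/2\<close>, of a harmonic Maass form whose image under \<open>\<xi>\<close> is
  a holomorphic modular form; \<open>ap\<close> and \<open>am\<close> are the coefficients of the holomorphic and of the
  non-holomorphic part. The values \<open>am n\<close> with \<open>n > 0\<close> play no role.
\<close>

definition Maass_expansion ::
    "(complex \<Rightarrow> complex) \<Rightarrow> (int \<Rightarrow> complex) \<Rightarrow> (int \<Rightarrow> complex) \<Rightarrow> bool" where
  "Maass_expansion g ap am \<longleftrightarrow>
     (\<exists>N. \<forall>n<N. ap n = 0) \<and>
     (\<forall>\<tau>\<in>uhp. \<exists>gp gm.
        ((\<lambda>n. ap n * e (of_int n * \<tau>)) has_sum gp) UNIV \<and>
        ((\<lambda>n. am n * of_real (upper_Gamma (-1/2) (4 * pi * \<bar>of_int n\<bar> * Im \<tau>))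
               * e (of_int n * \<tau>)) has_sum gm) {..<0} \<and>
        g \<tau> = gp + (am 0 * of_real (Im \<tau> powr (-1/2)) + gm))"


section \<open>The theta lift\<close>

text \<open>
  \<open>(a, b, c)\<close> stands for \<open>\<lambda> = (a, b/2, c)\<close> in the dual lattice of \<open>\<int>\<^sup>3\<close> with
  \<open>Q(a, b, c) = -b\<^sup>2 + ac\<close>, and \<open>Q_pos z\<close>, \<open>Q_neg z\<close> are the values of \<open>Q\<close> on the projections
  of \<open>\<lambda>\<close> to the positive line corresponding to \<open>z\<close> and to its orthogonal complement, so that
  \<open>Q_pos z (a, b, c) + Q_neg z (a, b, c) = ac - b\<^sup>2/4\<close>.
\<close>

definition Q_pos :: "complex \<Rightarrow> int \<times> int \<times> int \<Rightarrow> real" where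
  "Q_pos z = (\<lambda>(a, b, c).
     (of_int a * (norm z)\<^sup>2 + of_int b * Re z + of_int c)\<^sup>2 / (4 * (Im z)\<^sup>2))"

definition Q_neg :: "complex \<Rightarrow> int \<times> int \<times> int \<Rightarrow> real" where
  "Q_neg z = (\<lambda>(a, b, c).
     - (norm (of_int a * z\<^sup>2 + of_int b * z + of_int c))\<^sup>2 / (4 * (Im z)\<^sup>2))"

definition Theta :: "int \<Rightarrow> complex \<Rightarrow> complex \<Rightarrow> complex" where
  "Theta h \<tau> z = of_real (Im \<tau>) *
     (\<Sum>\<^sub>\<infinity>l\<in>{(a, b, c). b mod 2 = h mod 2}.
        e (of_real (Q_pos z l) * \<tau> + of_real (Q_neg z l) * cnj \<tau>))"

text \<open>
  \<open>f_part f r\<close> collects the exponents \<open>n \<equiv> r (mod 4)\<close>: for \<open>f\<close> in the plus space,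
  \<open>f(\<tau>) = f\<^sub>0(4\<tau>) + f\<^sub>1(4\<tau>)\<close> with \<open>f\<^sub>0 = f_part f 0\<close> and \<open>f\<^sub>1 = f_part f 3\<close>.
\<close>

definition f_part :: "(complex \<Rightarrow> complex) \<Rightarrow> int \<Rightarrow> complex \<Rightarrow> complex" where
  "f_part f r \<tau> = (\<Sum>\<^sub>\<infinity>n\<in>{n. n mod 4 = r}. q_coeff f n * e (of_int n / 4 * \<tau>))"

definition truncated_fundamental_domain :: "real \<Rightarrow> complex set" where
  "truncated_fundamental_domain T = {\<tau>\<in>uhp. \<bar>Re \<tau>\<bar> \<le> 1/2 \<and> norm \<tau> \<ge> 1 \<and> Im \<tau> \<le> T}"

definition truncated_lift :: "(complex \<Rightarrow> complex) \<Rightarrow> complex \<Rightarrow> real \<Rightarrow> complex" where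
  "truncated_lift f z T =
     (LINT \<tau>:truncated_fundamental_domain T|lborel.
        (f_part f 0 \<tau> * cnj (Theta 0 \<tau> z) + f_part f 3 \<tau> * cnj (Theta 1 \<tau> z))
        * of_real (Im \<tau> powr (-1/2) / (Im \<tau>)\<^sup>2))"

definition Phi :: "(complex \<Rightarrow> complex) \<Rightarrow> complex \<Rightarrow> complex" where
  "Phi f z = Lim at_top (truncated_lift f z)"

text \<open>
  On the plus space condition for the preimage of \<open>\<theta>\<close> under \<open>\<xi>\<close> (weight \<open>3/2\<close>): the lift
  pairs \<open>f\<close> with vector-valued forms for the Weil representation, which correspond to scalar-valued
  forms in the plus space, so the preimage has to be taken there too. It cannot be dropped: adding
  \<open>\<theta>\<^sup>3\<close> to a preimage gives another preimage outside the plus space, but for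
  \<open>D = 1\<close>, where \<open>f_D = q\<^sup>-\<^sup>1 + 10 - 64q\<^sup>3 + \<dots>\<close>, the sum of \<open>a(-d) ap(d - x\<^sup>2 - y\<^sup>2)\<close> over \<open>d\<close>, \<open>x\<close>, \<open>y\<close> then changes by \<open>12\<close>. It suffices to
  require it of the holomorphic part: the non-holomorphic part is determined by \<open>\<theta>\<close> and is
  supported on exponents \<open>-n\<^sup>2\<close>.
\<close>

end

theory Submission
  imports Defs "HOL-Complex_Analysis.Complex_Analysis"
begin

text \<open>
  For a function \<open>p\<close> on the upper half-plane put
  \<open>p\<^sup>#(\<tau>) = (p((\<tau> + 1)/4) + p((\<tau> - 1)/4))/2\<close> (\<open>quarter_avg\<close> below). If \<open>p\<close> has even weight \<open>k\<close>
  for \<open>\<Gamma>\<^sub>0(4)\<close> then \<open>p\<^sup>#(-1/\<tau>) = \<tau>\<^sup>k p\<^sup>#(\<tau>)\<close>, and if no exponent of \<open>p\<close> is \<open>2\<close> modulo \<open>4\<close> then \<open>p\<^sup>#\<close> is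
  \<open>1\<close>-periodic and collects the exponents divisible by \<open>4\<close>. At \<open>z = i\<close> the theta kernel splits, and the
  integrand of the lift is \<open>v\<^sup>-\<^sup>3\<^sup>/\<^sup>2 (f\<theta>)\<^sup># (\<bar>\<theta>\<bar>\<^sup>2)\<^sup>#\<close>, which up to a constant is the \<open>\<tau>\<close>-bar
  derivative of \<open>H = (f\<theta>)\<^sup># (g\<theta>)\<^sup>#\<close>, where \<open>g\<close> is the preimage of \<open>\<theta>\<close> under \<open>\<xi>\<close>. As \<open>H\<close> has weight
  \<open>2\<close> for the full modular group, Green's theorem on the truncated fundamental domain leaves only the integral
  over the top edge, i.e. the constant term of \<open>H\<close>; the non-holomorphic part of \<open>g\<close> contributes
  \<open>O(T\<^sup>-\<^sup>1\<^sup>/\<^sup>2)\<close> to it.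

  That \<open>g\<theta>\<close> has weight \<open>2\<close> needs \<open>J\<^sup>4 = (c\<tau> + d)\<^sup>2\<close> for \<open>J = \<theta>(\<gamma>\<tau>)/\<theta>(\<tau>)\<close>. This does not require Poisson
  summation: applying \<open>\<xi>\<close> to \<open>g(\<gamma>\<tau>) = J\<^sup>3 g(\<tau>)\<close> forces it.
\<close>

section \<open>Fourier expansions\<close>

lemma e_add: "e (x + y) = e x * e y"
  by (simp add: e_def exp_add ring_distribs)

lemma e_0 [simp]: "e 0 = 1"
  by (simp add: e_def)

lemma e_of_int [simp]: "e (of_int n) = 1"
  using exp_integer_2pi[of "of_int n"] by (simp add: e_def mult_ac)

lemma norm_e: "norm (e x) = exp (- 2 * pi * Im x)"
  by (simp add: e_def)

lemma cnj_e: "cnj (e x) = e (- cnj x)"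
  by (simp add: e_def exp_cnj)

lemma e_quarter [simp]: "e (1/4) = \<i>"
proof -
  have "e (1/4) = exp (\<i> * of_real (pi/2))"
    by (simp add: e_def field_simps)
  then show ?thesis by (simp only: cis_conv_exp [symmetric] cis_pi_half)
qed

lemma e_power: "e (of_nat n * x) = e x ^ n"
  by (simp add: e_def exp_of_nat_mult[symmetric] mult_ac)

lemma e_half [simp]: "e (1/2) = -1"
  using e_power[of 2 "1/4"] by simp

lemma e_minus: "e (- x) = inverse (e x)"
  by (simp add: e_def exp_minus)

lemma e_holomorphic [holomorphic_intros]: "f holomorphic_on S \<Longrightarrow> (\<lambda>x. e (f x)) holomorphic_on S"
  unfolding e_def by (intro holomorphic_intros)

lemma e_continuous [continuous_intros]: "continuous_on S f \<Longrightarrow> continuous_on S (\<lambda>x. e (f x))"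
  unfolding e_def by (intro continuous_intros)

lemma e_int_quarter:
  "e (of_int k / 4) = (if k mod 4 = 0 then 1 else if k mod 4 = 1 then \<i> else if k mod 4 = 2 then -1 else -\<i>)"
proof -
  obtain j r where k: "k = 4 * j + r" and r: "r \<in> {0,1,2,3}" "k mod 4 = r"
    by (rule that[of "k div 4" "k mod 4"]) (use pos_mod_bound[of 4 k] pos_mod_sign[of 4 k] in auto)
  have "(of_int k :: complex) / 4 = of_int j + of_int r / 4"
    by (simp add: k)
  then have "e (of_int k / 4) = e (of_int r / 4)"
    by (simp only: e_add e_of_int mult_1_left)
  moreover have "e (3/4) = -\<i>"
    using e_power[of 3 "1/4"] by (simp add: power3_eq_cube)
  ultimately show ?thesis using r by auto
qed

text \<open>Summability of complex families is absolute, so the family of products is summable by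
  its norms and may be summed iteratively. All products of Fourier expansions below are formed in
  this way.\<close>

lemma has_sum_mult_Times:
  fixes f g :: "_ \<Rightarrow> complex"
  assumes "(f has_sum a) A" "(g has_sum b) B"
  shows "((\<lambda>(x, y). f x * g y) has_sum a * b) (A \<times> B)"
proof (rule has_sum_SigmaI)
  have f: "f summable_on A" and g: "g summable_on B"
    using assms has_sum_imp_summable by blast+
  show "((\<lambda>y. case (x, y) of (x, y) \<Rightarrow> f x * g y) has_sum f x * b) B" for x
    using assms(2) by (simp add: has_sum_cmult_right)
  show "((\<lambda>x. f x * b) has_sum a * b) A"
    using assms(1) by (rule has_sum_cmult_left)
  have "(\<lambda>(x,y). norm (f x) * norm (g y)) summable_on A \<times> B"
  proof (rule summable_on_SigmaI)
    show "((\<lambda>y. case (x, y) of (x, y) \<Rightarrow> norm (f x) * norm (g y)) has_sum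
             norm (f x) * (\<Sum>\<^sub>\<infinity>y\<in>B. norm (g y))) B" for x
      using g by (simp add: has_sum_cmult_right summable_on_iff_abs_summable_on_complex)
    show "(\<lambda>x. norm (f x) * (\<Sum>\<^sub>\<infinity>y\<in>B. norm (g y))) summable_on A"
      using f by (intro summable_on_cmult_left) (simp add: summable_on_iff_abs_summable_on_complex)
  qed auto
  then show "(\<lambda>(x, y). f x * g y) summable_on A \<times> B"
    by (simp add: summable_on_iff_abs_summable_on_complex norm_mult case_prod_unfold)
qed

section \<open>Termwise integration over a period\<close>

lemma integral_e_of_int:
  "((\<lambda>u::real. e (of_int k * of_real u)) has_integral (if k = 0 then 1 else 0)) {-1/2..1/2}"
proof (cases "k = 0")
  case True
  then show ?thesis using has_integral_const_real[of "1::complex" "-1/2" "1/2"] by simp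
next
  case False
  have "((\<lambda>u::real. e (of_int k * of_real u)) has_integral
      e (of_int k * of_real (1/2)) / (2 * of_real pi * \<i> * of_int k)
      - e (of_int k * of_real (-1/2)) / (2 * of_real pi * \<i> * of_int k)) {-1/2..1/2}"
  proof (rule fundamental_theorem_of_calculus)
    fix u :: real
    have "((\<lambda>z. e (of_int k * z) / (2 * of_real pi * \<i> * of_int k)) has_field_derivative
        e (of_int k * of_real u)) (at (of_real u))"
      unfolding e_def using False by (auto intro!: derivative_eq_intros)
    then show "((\<lambda>u. e (of_int k * of_real u) / (2 * of_real pi * \<i> * of_int k))
        has_vector_derivative e (of_int k * of_real u)) (at u within {-1/2..1/2})"
      by (rule has_vector_derivative_real_field)
  qed simp
  moreover have "e (of_int k * of_real (1/2)) = e (of_int k * of_real (-1/2))"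
    using e_add[of "of_int k * of_real (-1/2)" "of_int k"] by simp
  ultimately show ?thesis using False by simp
qed

text \<open>The norms of \<open>c i\<close> majorize the terms uniformly in \<open>u\<close>, so
  integration passes to the limit of the finite partial sums. The frequencies \<open>k i\<close> may
  repeat, which admits series indexed by pairs whose equal exponents have not been
  collected.\<close>

lemma fourier_infsum:
  fixes c :: "'i \<Rightarrow> complex" and k :: "'i \<Rightarrow> int"
  assumes "c summable_on I"
  shows "((\<lambda>u::real. \<Sum>\<^sub>\<infinity>i\<in>I. c i * e (of_int (k i) * of_real u)) has_integral
           (\<Sum>\<^sub>\<infinity>i\<in>{i\<in>I. k i = 0}. c i)) {-1/2..1/2}"
proof -
  have ul: "uniform_limit {-1/2..1/2} (\<lambda>X u. \<Sum>i\<in>X. c i * e (of_int (k i) * of_real u))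
     (\<lambda>u::real. \<Sum>\<^sub>\<infinity>i\<in>I. c i * e (of_int (k i) * of_real u)) (finite_subsets_at_top I)"
    using assms
    by (intro Weierstrass_m_test_general[where M = "\<lambda>i. norm (c i)"])
       (auto simp: norm_mult norm_e summable_on_iff_abs_summable_on_complex)
  obtain S J where S: "\<And>X. ((\<lambda>u. \<Sum>i\<in>X. c i * e (of_int (k i) * of_real u)) has_integral S X) {-1/2..1/2::real}"
      and J: "((\<lambda>u::real. \<Sum>\<^sub>\<infinity>i\<in>I. c i * e (of_int (k i) * of_real u)) has_integral J) {-1/2..1/2}"
      and lim: "(S \<longlongrightarrow> J) (finite_subsets_at_top I)"
    by (rule uniform_limit_integral[OF ul]) (auto intro!: continuous_intros)
  have S_eq: "S X = (\<Sum>i\<in>X. if k i = 0 then c i else 0)" if "finite X" for X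
  proof -
    have "((\<lambda>u. \<Sum>i\<in>X. c i * e (of_int (k i) * of_real u)) has_integral
        (\<Sum>i\<in>X. c i * (if k i = 0 then 1 else 0))) {-1/2..1/2::real}"
      using that by (intro has_integral_sum has_integral_mult_right integral_e_of_int)
    from has_integral_unique[OF S this] show ?thesis
      by (simp add: if_distrib cong: if_cong)
  qed
  \<comment> \<open>\<open>has_sum\<close> is convergence of the finite partial sums along exactly
    this filter, so \<open>lim\<close> identifies \<open>J\<close> as the sum over the indices of
    frequency 0.\<close>
  have "((\<lambda>i. if k i = 0 then c i else 0) has_sum J) I"
    unfolding has_sum_def using lim
    by (rule Lim_transform_eventually)
       (auto intro!: eventually_finite_subsets_at_top_weakI simp: S_eq)
  then have "(c has_sum J) {i\<in>I. k i = 0}"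
    by (subst has_sum_cong_neutral[where T = I and g = "\<lambda>i. if k i = 0 then c i else 0"]) auto
  with J show ?thesis by (simp add: infsumI)
qed

text \<open>On the line at height \<open>v\<close> the factor depending on \<open>v\<close> is
  absorbed into the coefficient, and it equals 1 at frequency 0. As \<open>v\<close> is fixed, the
  coefficients may themselves depend on the height.\<close>

lemma constant_term_has_integral:
  fixes c :: "'i \<Rightarrow> complex" and k :: "'i \<Rightarrow> int"
  assumes "\<And>u. ((\<lambda>i. c i * e (of_int (k i) * Complex u v)) has_sum f u) I"
  shows "(f has_integral (\<Sum>\<^sub>\<infinity>i\<in>{i\<in>I. k i = 0}. c i)) {-1/2..1/2}"
proof -
  have C: "Complex u v = of_real u + \<i> * of_real v" for u
    by (simp add: complex_eq_iff)
  have eq: "c i * e (of_int (k i) * Complex u v)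
      = (c i * e (of_int (k i) * (\<i> * of_real v))) * e (of_int (k i) * of_real u)" for i u
    by (simp add: C distrib_left e_add)
  have "(\<lambda>i. c i * e (of_int (k i) * (\<i> * of_real v))) summable_on I"
    using has_sum_imp_summable[OF assms[of 0]] by (simp add: C)
  from fourier_infsum[OF this, of k] have
    "((\<lambda>u. \<Sum>\<^sub>\<infinity>i\<in>I. c i * e (of_int (k i) * Complex u v)) has_integral
       (\<Sum>\<^sub>\<infinity>i\<in>{i\<in>I. k i = 0}. c i * e (of_int (k i) * (\<i> * of_real v)))) {-1/2..1/2}"
    by (simp only: eq)
  also have "(\<lambda>u. \<Sum>\<^sub>\<infinity>i\<in>I. c i * e (of_int (k i) * Complex u v)) = f"
    using assms by (intro ext infsumI)
  also have "(\<Sum>\<^sub>\<infinity>i\<in>{i\<in>I. k i = 0}. c i * e (of_int (k i) * (\<i> * of_real v)))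
      = (\<Sum>\<^sub>\<infinity>i\<in>{i\<in>I. k i = 0}. c i)"
    by (intro infsum_cong) simp
  finally show ?thesis .
qed

text \<open>Multiplication by \<open>e (- of_int n * \<tau>)\<close> moves the \<open>n\<close>-th
  coefficient to frequency 0, so it is determined by the values of \<open>f\<close> on a segment at
  height 1.\<close>

lemma q_expansion_unique:
  assumes "q_expansion f a" "q_expansion f b"
  shows "a = b"
proof
  fix n
  have "((\<lambda>u. f (Complex u 1) * e (- of_int n * Complex u 1)) has_integral a n) {-1/2..1/2}"
    if "q_expansion f a" for a
  proof -
    have "((\<lambda>m. a m * e (of_int (m - n) * Complex u 1)) has_sum
        f (Complex u 1) * e (- of_int n * Complex u 1)) UNIV" for u
    proof -
      have "((\<lambda>m. a m * e (of_int m * Complex u 1)) has_sum f (Complex u 1)) UNIV"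
        using that by (auto simp: q_expansion_def uhp_def)
      from has_sum_cmult_left[OF this, of "e (- of_int n * Complex u 1)"]
      show ?thesis by (simp add: mult.assoc e_add[symmetric] left_diff_distrib)
    qed
    from constant_term_has_integral[OF this] show ?thesis by simp
  qed
  from has_integral_unique[OF this[OF assms(1)] this[OF assms(2)]] show "a n = b n" .
qed

lemma q_coeff_eq: "q_expansion f a \<Longrightarrow> q_coeff f = a"
  unfolding q_coeff_def by (rule the_equality) (auto intro: q_expansion_unique)


section \<open>The theta multiplier\<close>

lemma summable_on_power_abs_int:
  fixes r :: real
  assumes "0 \<le> r" "r < 1"
  shows "(\<lambda>n::int. r ^ nat \<bar>n\<bar>) summable_on UNIV"
proof -
  have g: "(\<lambda>n::nat. r ^ n) summable_on UNIV"
    using assms by (intro summable_nonneg_imp_summable_on) (auto simp: summable_geometric)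
  have "(\<lambda>n::int. r ^ nat \<bar>n\<bar>) summable_on range int"
    using g by (subst summable_on_reindex) (auto simp: o_def)
  moreover have "(\<lambda>n::int. r ^ nat \<bar>n\<bar>) summable_on range (\<lambda>n. - int n)"
    using g by (subst summable_on_reindex) (auto simp: o_def inj_on_def)
  ultimately have "(\<lambda>n::int. r ^ nat \<bar>n\<bar>) summable_on range int \<union> range (\<lambda>n. - int n)"
    by (rule summable_on_union)
  also have "range int \<union> range (\<lambda>n. - int n) = UNIV"
    by (auto simp: image_iff) (metis int_cases2)
  finally show ?thesis .
qed

text \<open>An integer is bounded in absolute value by its square, so a geometric series dominates
  the theta series uniformly at height at least \<delta>. The same majorant gives convergence and
  holomorphy.\<close>

lemma norm_e_square_le:
  assumes "\<delta> > 0" "Im \<tau> \<ge> \<delta>"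
  shows "norm (e (of_int (n\<^sup>2) * \<tau>)) \<le> exp (- 2 * pi * \<delta>) ^ nat \<bar>n\<bar>"
proof -
  have "real (nat \<bar>n\<bar>) * \<delta> \<le> of_int (n\<^sup>2) * Im \<tau>"
  proof (rule mult_mono)
    have "\<bar>n\<bar> \<le> n\<^sup>2"
      by (metis abs_ge_zero abs_mult_self_eq int_one_le_iff_zero_less less_le mult_le_cancel_right1 not_less power2_eq_square zero_le_square)
    then have "real_of_int \<bar>n\<bar> \<le> of_int (n\<^sup>2)" by (subst of_int_le_iff)
    then show "real (nat \<bar>n\<bar>) \<le> of_int (n\<^sup>2)" by simp
  qed (use assms in auto)
  then have "real (nat \<bar>n\<bar>) * (- 2 * pi * \<delta>) \<ge> - 2 * pi * (of_int (n\<^sup>2) * Im \<tau>)"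
    using mult_left_mono[of _ _ "2 * pi"] by (simp add: mult_ac)
  then show ?thesis
    by (simp add: norm_e exp_of_nat_mult[symmetric])
qed

lemma open_uhp: "open uhp"
  unfolding uhp_def by (rule open_halfspace_Im_gt)

lemma connected_uhp: "connected uhp"
  unfolding uhp_def by (intro convex_connected convex_halfspace_Im_gt)

lemma theta_has_sum:
  assumes "\<tau> \<in> uhp"
  shows "((\<lambda>n::int. e (of_int (n\<^sup>2) * \<tau>)) has_sum theta \<tau>) UNIV"
proof -
  have "(\<lambda>n::int. norm (e (of_int (n\<^sup>2) * \<tau>))) summable_on UNIV"
  proof (rule Infinite_Sum.abs_summable_on_comparison_test')
    show "(\<lambda>n::int. exp (- 2 * pi * Im \<tau>) ^ nat \<bar>n\<bar>) summable_on UNIV"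
      using assms by (intro summable_on_power_abs_int) (auto simp: uhp_def)
    show "norm (e (of_int (n\<^sup>2) * \<tau>)) \<le> exp (- 2 * pi * Im \<tau>) ^ nat \<bar>n\<bar>" for n :: int
      using assms by (intro norm_e_square_le) (auto simp: uhp_def)
  qed
  then show ?thesis
    unfolding theta_def by (intro has_sum_infsum) (rule abs_summable_summable)
qed

lemma theta_holomorphic: "theta holomorphic_on uhp"
proof (unfold holomorphic_on_def, intro ballI)
  fix z assume z: "z \<in> uhp"
  \<comment> \<open>This radius keeps the closed disc at height at least \<open>r\<close>, where one
    majorant serves for all points.\<close>
  define r where "r = Im z / 2"
  have r: "r > 0" using z by (auto simp: r_def uhp_def)
  have Im: "Im w \<ge> r" if "w \<in> cball z r" for w
    using that abs_Im_le_cmod[of "z - w"] r by (auto simp: dist_norm r_def)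
  have "uniform_limit (cball z r) (\<lambda>X \<tau>. \<Sum>n\<in>X. e (of_int (n\<^sup>2) * \<tau>)) theta (finite_subsets_at_top UNIV)"
    using Im r norm_e_square_le[of r]
    by (intro Weierstrass_m_test_general'[where M = "\<lambda>n::int. exp (- 2 * pi * r) ^ nat \<bar>n\<bar>"]
          theta_has_sum summable_on_power_abs_int) (auto simp: uhp_def intro: less_le_trans)
  then have "theta holomorphic_on ball z r"
    by (rule holomorphic_uniform_limit[rotated])
       (auto intro!: always_eventually continuous_intros holomorphic_intros)
  then have "theta field_differentiable at z"
    using r by (auto simp: holomorphic_on_open field_differentiable_def)
  then show "theta field_differentiable at z within uhp"
    by (rule field_differentiable_at_within)
qed

text \<open>At \<open>\<i>\<close> every term is a positive real and the term for 0 is 1, so the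
  real part is at least 1.\<close>

lemma theta_i_nonzero: "theta \<i> \<noteq> 0"
proof -
  have "((\<lambda>n::int. Re (e (of_int (n\<^sup>2) * \<i>))) has_sum Re (theta \<i>)) UNIV"
    by (intro has_sum_Re theta_has_sum) (simp add: uhp_def)
  then have "(\<Sum>n\<in>{0::int}. Re (e (of_int (n\<^sup>2) * \<i>))) \<le> Re (theta \<i>)"
  proof (rule finite_sum_le_has_sum)
    fix n :: int
    have "e (of_int (n\<^sup>2) * \<i>) = exp (of_real (- 2 * pi * of_int (n\<^sup>2)))"
      unfolding e_def by (intro arg_cong[where f = exp]) (simp add: complex_eq_iff)
    then show "0 \<le> Re (e (of_int (n\<^sup>2) * \<i>))"
      by (simp only: exp_of_real Re_complex_of_real exp_ge_zero)
  qed auto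
  then show ?thesis by auto
qed

text \<open>The composite is holomorphic and takes the nonzero value \<open>theta \<i>\<close>, so
  its zeros are isolated. Hence the quotient of thetas in \<open>modular_Gamma0_4\<close> can be
  cleared on a punctured neighbourhood of any point.\<close>

lemma eventually_theta_comp_nonzero:
  assumes "f holomorphic_on uhp" "f ` uhp \<subseteq> uhp" "\<i> \<in> f ` uhp" "\<tau> \<in> uhp"
  shows "\<forall>\<^sub>F w in at \<tau>. theta (f w) \<noteq> 0 \<and> w \<in> uhp"
proof -
  obtain \<beta> where \<beta>: "\<beta> \<in> uhp" "f \<beta> = \<i>" using assms(3) by auto
  have "(theta \<circ> f) holomorphic_on uhp"
    by (rule holomorphic_on_compose_gen[OF assms(1) theta_holomorphic assms(2)])
  from non_zero_neighbour_alt[OF this open_uhp connected_uhp assms(4) \<beta>(1)]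
  show ?thesis using \<beta> theta_i_nonzero by simp
qed

section \<open>Action of the matrices with rows (1, 0) and (c, 1)\<close>

lemma moebius_1_0:
  "moebius 1 0 c 1 \<tau> = \<tau> / (of_int c * \<tau> + 1)"
  by (simp add: moebius_def)

lemma cocycle_nonzero:
  assumes "\<tau> \<in> uhp" shows "of_int c * \<tau> + 1 \<noteq> 0"
proof
  assume *: "of_int c * \<tau> + 1 = 0"
  then have "Im (of_int c * \<tau> + 1) = 0" by (simp only: zero_complex.sel)
  then have "c = 0" using assms by (simp add: uhp_def)
  with * show False by simp
qed

lemma Im_moebius_1_0:
  "Im (moebius 1 0 c 1 \<tau>) = Im \<tau> / (norm (of_int c * \<tau> + 1))\<^sup>2"
  by (simp add: moebius_1_0 Im_divide cmod_power2) (simp add: field_simps)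

lemma moebius_in_uhp: "\<tau> \<in> uhp \<Longrightarrow> moebius 1 0 c 1 \<tau> \<in> uhp"
  using cocycle_nonzero[of \<tau> c] by (simp add: uhp_def Im_moebius_1_0)

lemma moebius_holomorphic: "moebius 1 0 c 1 holomorphic_on uhp"
  unfolding moebius_1_0[abs_def] using cocycle_nonzero by (auto intro!: holomorphic_intros)

lemma moebius_inverse:
  assumes "\<tau> \<in> uhp" shows "moebius 1 0 c 1 (moebius 1 0 (- c) 1 \<tau>) = \<tau>"
proof -
  have "1 - of_int c * \<tau> \<noteq> 0" using cocycle_nonzero[OF assms, of "- c"] by simp
  then show ?thesis by (simp add: moebius_1_0 field_simps)
qed

text \<open>The matrix with entry \<open>- c\<close> supplies a preimage of \<open>\<i>\<close>
  under the one with entry \<open>c\<close>, so the previous criterion applies to both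
  functions.\<close>

lemma eventually_theta_moebius_nonzero:
  assumes "\<tau> \<in> uhp"
  shows "\<forall>\<^sub>F w in at \<tau>. theta w \<noteq> 0 \<and> theta (moebius 1 0 c 1 w) \<noteq> 0 \<and> w \<in> uhp"
proof -
  have i: "\<i> \<in> uhp" by (simp add: uhp_def)
  have "\<forall>\<^sub>F w in at \<tau>. theta (moebius 1 0 c 1 w) \<noteq> 0 \<and> w \<in> uhp"
    using moebius_inverse[OF i, of c] moebius_in_uhp[OF i, of "- c"] assms
    by (intro eventually_theta_comp_nonzero moebius_holomorphic) (auto simp: image_iff moebius_in_uhp intro!: bexI)
  moreover have "\<forall>\<^sub>F w in at \<tau>. theta w \<noteq> 0 \<and> w \<in> uhp"
    using i assms by (intro eventually_theta_comp_nonzero[where f = "\<lambda>x. x"]) auto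
  ultimately show ?thesis by eventually_elim auto
qed

text \<open>Carries identities established off the zeros of \<open>theta\<close> over to the zeros
  themselves.\<close>

lemma continuous_eq_at:
  fixes f g :: "complex \<Rightarrow> complex"
  assumes "continuous_on uhp f" "continuous_on uhp g" "\<tau> \<in> uhp" "\<forall>\<^sub>F w in at \<tau>. f w = g w"
  shows "f \<tau> = g \<tau>"
proof -
  have "(f \<longlongrightarrow> f \<tau>) (at \<tau>)" "(g \<longlongrightarrow> g \<tau>) (at \<tau>)"
    using assms open_uhp by (auto simp: continuous_on_eq_continuous_at isCont_def)
  moreover from this(1) assms(4) have "(g \<longlongrightarrow> f \<tau>) (at \<tau>)"
    by (rule Lim_transform_eventually)
  ultimately show ?thesis using tendsto_unique[OF trivial_limit_at] by blast
qed

lemma theta_continuous: "continuous_on uhp theta"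
  using theta_holomorphic by (rule holomorphic_on_imp_continuous_on)

lemma continuous_on_moebius_comp:
  assumes "continuous_on uhp f" shows "continuous_on uhp (\<lambda>w. f (moebius 1 0 c 1 w))"
  using assms holomorphic_on_imp_continuous_on[OF moebius_holomorphic]
  by (rule continuous_on_compose2) (auto simp: moebius_in_uhp)

text \<open>Where both values of \<open>theta\<close> are nonzero, the automorphy factor of
  \<open>f\<close> is the inverse of the quotient by which \<open>theta\<close> changes, and the two
  cancel.\<close>

lemma theta_product_weight_0:
  assumes "modular_Gamma0_4 (-1) f" "continuous_on uhp f" "4 dvd c" "\<tau> \<in> uhp"
  shows "f (moebius 1 0 c 1 \<tau>) * theta (moebius 1 0 c 1 \<tau>) = f \<tau> * theta \<tau>"
proof (rule continuous_eq_at[OF _ _ assms(4)])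
  show "\<forall>\<^sub>F w in at \<tau>. f (moebius 1 0 c 1 w) * theta (moebius 1 0 c 1 w) = f w * theta w"
    using eventually_theta_moebius_nonzero[OF assms(4), of c]
  proof eventually_elim
    case (elim w)
    have "f (moebius 1 0 c 1 w) = (theta (moebius 1 0 c 1 w) / theta w) powi (-1) * f w"
      using assms(1,3) elim unfolding modular_Gamma0_4_def by fastforce
    then show ?case using elim by (simp add: field_simps)
  qed
qed (intro continuous_intros assms theta_continuous continuous_on_moebius_comp)+

section \<open>Real derivatives and the equation for xi\<close>

lemma has_derivative_d_u_d_v:
  assumes "g differentiable_on uhp" "\<tau> \<in> uhp"
  shows "(g has_derivative (\<lambda>h. of_real (Re h) * d_u g \<tau> + of_real (Im h) * d_v g \<tau>)) (at \<tau>)"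
proof -
  obtain L where L: "(g has_derivative L) (at \<tau>)"
    using assms open_uhp by (auto simp: differentiable_on_def differentiable_def at_within_open[OF assms(2) open_uhp])
  have lin: "linear L" using L by (rule has_derivative_linear)
  have dir: "vector_derivative (\<lambda>t::real. g (\<tau> + k * of_real t)) (at 0) = L k" for k
  proof (rule vector_derivative_at)
    have "((\<lambda>t::real. \<tau> + k * of_real t) has_derivative (\<lambda>t. k * of_real t)) (at 0)"
      by (auto intro!: derivative_eq_intros)
    from has_derivative_compose[OF this, of g L] L
    have "((\<lambda>t::real. g (\<tau> + k * of_real t)) has_derivative (\<lambda>t. L (k * of_real t))) (at 0)"
      by simp
    moreover have "L (k * of_real t) = t *\<^sub>R L k" for t
      using linear_scale[OF lin, of t k] by (simp add: scaleR_conv_of_real mult.commute)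
    ultimately show "((\<lambda>t::real. g (\<tau> + k * of_real t)) has_vector_derivative L k) (at 0)"
      by (simp add: has_vector_derivative_def)
  qed
  have "L h = of_real (Re h) * d_u g \<tau> + of_real (Im h) * d_v g \<tau>" for h
  proof -
    have "h = Re h *\<^sub>R 1 + Im h *\<^sub>R \<i>" by (simp add: complex_eq_iff)
    then have "L h = Re h *\<^sub>R L 1 + Im h *\<^sub>R L \<i>"
      by (metis linear_add[OF lin] linear_scale[OF lin])
    then show ?thesis using dir[of 1] dir[of \<i>]
      by (simp add: d_u_def d_v_def scaleR_conv_of_real)
  qed
  then have "L = (\<lambda>h. of_real (Re h) * d_u g \<tau> + of_real (Im h) * d_v g \<tau>)" ..
  with L show ?thesis by simp
qed

text \<open>The definition of \<open>xi\<close> is solved for the conjugate derivative; the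
  left-hand side is twice \<open>d_taubar g \<tau>\<close>.\<close>

lemma d_taubar_of_xi_theta:
  assumes "xi (3/2) g \<tau> = theta \<tau>" "\<tau> \<in> uhp"
  shows "d_u g \<tau> + \<i> * d_v g \<tau> = \<i> * of_real (Im \<tau> powr (-3/2)) * cnj (theta \<tau>)"
proof -
  have v: "Im \<tau> > 0" using assms by (simp add: uhp_def)
  have p: "Im \<tau> powr (-3/2) * Im \<tau> powr (3/2) = 1"
    using v by (simp add: powr_add[symmetric])
  have "cnj (theta \<tau>) = - 2 * \<i> * of_real (Im \<tau> powr (3/2)) * d_taubar g \<tau>"
    unfolding assms(1)[symmetric] xi_def by simp
  then have "\<i> * of_real (Im \<tau> powr (-3/2)) * cnj (theta \<tau>)
     = 2 * of_real (Im \<tau> powr (-3/2) * Im \<tau> powr (3/2)) * d_taubar g \<tau>"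
    by (simp add: mult_ac)
  then show ?thesis by (simp only: p) (simp add: d_taubar_def)
qed

text \<open>When \<open>g (\<gamma> z) = J z ^ 3 * g z\<close> is differentiated with respect to
  \<tau>-bar, the derivative of the holomorphic \<open>J\<close> drops out, and the known
  derivatives of \<open>g\<close> leave an equation between \<open>J\<close>, \<open>j\<close> and
  their conjugates. Its absolute value gives \<open>norm j = norm (J w) ^ 2\<close>; fed back into
  the equation, this yields \<open>J w ^ 4 = j ^ 2\<close>, the factor of the product of
  \<open>g\<close> and \<open>theta\<close>.\<close>

lemma theta_product_weight_2:
  assumes "modular_Gamma0_4 3 g" "g differentiable_on uhp" "\<forall>\<tau>\<in>uhp. xi (3/2) g \<tau> = theta \<tau>"
    and "4 dvd c" "\<tau> \<in> uhp"
  shows "g (moebius 1 0 c 1 \<tau>) * theta (moebius 1 0 c 1 \<tau>) = (of_int c * \<tau> + 1)\<^sup>2 * (g \<tau> * theta \<tau>)"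
proof (rule continuous_eq_at[OF _ _ assms(5)])
  have cont: "continuous_on uhp g" using assms(2) by (rule differentiable_imp_continuous_on)
  show "continuous_on uhp (\<lambda>\<tau>. g (moebius 1 0 c 1 \<tau>) * theta (moebius 1 0 c 1 \<tau>))"
    by (intro continuous_intros theta_continuous continuous_on_moebius_comp cont)
  show "continuous_on uhp (\<lambda>\<tau>. (of_int c * \<tau> + 1)\<^sup>2 * (g \<tau> * theta \<tau>))"
    by (intro continuous_intros theta_continuous cont)
  show "\<forall>\<^sub>F w in at \<tau>. g (moebius 1 0 c 1 w) * theta (moebius 1 0 c 1 w)
      = (of_int c * w + 1)\<^sup>2 * (g w * theta w)"
    using eventually_theta_moebius_nonzero[OF assms(5), of c]
  proof eventually_elim
    case (elim w)
    define \<gamma> where "\<gamma> = moebius 1 0 c 1"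
    define J where "J = (\<lambda>w. theta (\<gamma> w) / theta w)"
    define j where "j = of_int c * w + 1"
    have w: "w \<in> uhp" "\<gamma> w \<in> uhp" and nz: "theta w \<noteq> 0" "theta (\<gamma> w) \<noteq> 0" and j: "j \<noteq> 0"
      using elim moebius_in_uhp cocycle_nonzero[of w c] by (auto simp: \<gamma>_def j_def)
    have gJ: "g (\<gamma> z) = J z ^ 3 * g z" if "z \<in> uhp" for z
    proof -
      have "g (\<gamma> z) = J z powi 3 * g z"
        using assms(1,4) that unfolding modular_Gamma0_4_def J_def \<gamma>_def by fastforce
      then show ?thesis by (simp add: power_int_def)
    qed
    \<comment> \<open>An open set around \<open>w\<close> on which the quotient \<open>J\<close> is
      holomorphic.\<close>
    define S where "S = uhp \<inter> theta -` (- {0})"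
    have S: "open S" "w \<in> S"
      unfolding S_def using w nz
      by (auto intro!: continuous_open_preimage theta_continuous open_uhp)
    have "J holomorphic_on S"
      unfolding J_def S_def \<gamma>_def
      by (intro holomorphic_on_divide holomorphic_on_compose_gen[OF holomorphic_on_subset[OF moebius_holomorphic]
             theta_holomorphic, unfolded o_def] holomorphic_on_subset[OF theta_holomorphic])
         (auto simp: moebius_in_uhp)
    then have "(\<lambda>z. J z ^ 3) holomorphic_on S" by (intro holomorphic_intros)
    then obtain K where K: "((\<lambda>z. J z ^ 3) has_field_derivative K) (at w)"
      using S by (auto simp: holomorphic_on_open field_differentiable_def)
    note Dg = has_derivative_d_u_d_v[OF assms(2)]
    have R: "((\<lambda>z. J z ^ 3 * g z) has_derivative
        (\<lambda>h. J w ^ 3 * (of_real (Re h) * d_u g w + of_real (Im h) * d_v g w) + K * h * g w)) (at w)"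
      by (rule has_derivative_mult[OF K[unfolded has_field_derivative_def] Dg[OF w(1)]])
    have \<gamma>': "(\<gamma> has_field_derivative 1 / j\<^sup>2) (at w)"
      unfolding \<gamma>_def moebius_1_0[abs_def] using j unfolding j_def
      by (auto intro!: derivative_eq_intros simp: power2_eq_square field_simps)
    have "((\<lambda>z. g (\<gamma> z)) has_derivative
        (\<lambda>h. of_real (Re (1 / j\<^sup>2 * h)) * d_u g (\<gamma> w) + of_real (Im (1 / j\<^sup>2 * h)) * d_v g (\<gamma> w))) (at w)"
      by (rule has_derivative_compose[OF \<gamma>'[unfolded has_field_derivative_def] Dg[OF w(2)]])
    then have L: "((\<lambda>z. J z ^ 3 * g z) has_derivative
        (\<lambda>h. of_real (Re (1 / j\<^sup>2 * h)) * d_u g (\<gamma> w) + of_real (Im (1 / j\<^sup>2 * h)) * d_v g (\<gamma> w))) (at w)"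
      by (rule has_derivative_transform_within_open[OF _ open_uhp w(1)]) (rule gJ)
    from has_derivative_unique[OF L R]
    have LR: "of_real (Re (1 / j\<^sup>2 * h)) * d_u g (\<gamma> w) + of_real (Im (1 / j\<^sup>2 * h)) * d_v g (\<gamma> w)
        = J w ^ 3 * (of_real (Re h) * d_u g w + of_real (Im h) * d_v g w) + K * h * g w" for h
      by (rule fun_cong)
    define k where "k = 1 / j\<^sup>2"
    have cnj_k: "cnj k = of_real (Re k) - \<i> * of_real (Im k)"
      by (simp add: complex_eq_iff)
    \<comment> \<open>Here \<open>k\<close> is the derivative of \<open>\<gamma>\<close> at
      \<open>w\<close>. The \<tau>-bar derivative is \<open>LR\<close> at \<open>h = 1\<close> plus
      \<open>\<i>\<close> times \<open>LR\<close> at \<open>h = \<i>\<close>, and the terms with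
      \<open>K\<close> cancel because \<open>\<i> * \<i> = -1\<close>.\<close>
    have "cnj k * (d_u g (\<gamma> w) + \<i> * d_v g (\<gamma> w))
       = (of_real (Re (k * 1)) * d_u g (\<gamma> w) + of_real (Im (k * 1)) * d_v g (\<gamma> w))
         + \<i> * (of_real (Re (k * \<i>)) * d_u g (\<gamma> w) + of_real (Im (k * \<i>)) * d_v g (\<gamma> w))"
      by (simp add: cnj_k algebra_simps)
    also have "\<dots> = J w ^ 3 * (d_u g w + \<i> * d_v g w)"
      unfolding k_def LR by (simp add: algebra_simps)
    finally have eq: "cnj k * (\<i> * of_real (Im (\<gamma> w) powr (-3/2)) * cnj (theta (\<gamma> w)))
        = J w ^ 3 * (\<i> * of_real (Im w powr (-3/2)) * cnj (theta w))"
      using w assms(3) by (simp only: d_taubar_of_xi_theta)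
    have v: "Im w > 0" using w by (simp add: uhp_def)
    have Im_\<gamma>: "Im (\<gamma> w) = Im w / (norm j)\<^sup>2"
      by (simp add: \<gamma>_def Im_moebius_1_0 j_def)
    have "Im (\<gamma> w) powr (-3/2) = Im w powr (-3/2) * norm j ^ 3"
    proof -
      have "Im (\<gamma> w) powr (-3/2) = Im w powr (-3/2) * ((norm j)\<^sup>2) powr (3/2)"
        using v j by (simp add: Im_\<gamma> powr_divide powr_minus field_simps)
      also have "((norm j)\<^sup>2) powr (3/2) = norm j ^ 3"
        using j powr_powr[of "norm j" 2 "3/2"] by simp
      finally show ?thesis .
    qed
    moreover have "cnj (theta (\<gamma> w)) = cnj (J w) * cnj (theta w)"
      using nz by (simp add: J_def)
    ultimately have "cnj k * of_real (norm j ^ 3) * cnj (J w) = J w ^ 3"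
      using eq v nz by (simp add: mult_ac)
    then have eq2: "of_real (norm j ^ 3) * cnj (J w) = cnj j ^ 2 * J w ^ 3"
      using j by (auto simp: k_def field_simps)
    have J: "J w \<noteq> 0" using nz by (simp add: J_def)
    have "norm j ^ 3 * norm (J w) = norm j ^ 2 * norm (J w) ^ 3"
      using arg_cong[OF eq2, of norm] by (simp add: norm_mult norm_power)
    then have nJ: "norm j = norm (J w) ^ 2"
      using j J by (simp add: power2_eq_square power3_eq_cube)
    have "cnj j ^ 2 * J w ^ 4 = of_real (norm j ^ 3) * (J w * cnj (J w))"
      using eq2 by (simp add: power4_eq_xxxx power3_eq_cube mult_ac)
    also have "\<dots> = of_real (norm j ^ 4)"
      by (simp add: complex_norm_square[symmetric] nJ flip: of_real_mult of_real_power)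
    also have "\<dots> = cnj j ^ 2 * j ^ 2"
      using complex_norm_square[of j] by (simp add: power4_eq_xxxx power2_eq_square mult_ac)
    finally have "J w ^ 4 = j ^ 2" using j by simp
    moreover have "g (\<gamma> w) * theta (\<gamma> w) = J w ^ 4 * (g w * theta w)"
      using nz gJ[OF w(1)] by (simp add: J_def field_simps eval_nat_numeral)
    ultimately show ?case by (simp add: \<gamma>_def j_def)
  qed
qed


section \<open>The expansion of a preimage of theta\<close>

text \<open>The power is at most its value at \<open>x\<close>, which leaves an integrable
  exponential. The parameter \<open>m\<close> covers the rescaled integrand in
  \<open>upper_Gamma_scale_le\<close>.\<close>

lemma gamma_integrand_integrable:
  assumes "x > 0" "m > 0"
  shows "set_integrable lborel {x..} (\<lambda>t::real. exp (- (m * t)) * t powr (-3/2))"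
proof (rule set_integrable_bound)
  have "(\<lambda>t. exp (- m * t)) integrable_on {x..}"
    using assms by (intro integrable_on_exp_minus_to_infinity)
  then have "(\<lambda>t. exp (- m * t)) absolutely_integrable_on {x..}"
    by (intro nonnegative_absolutely_integrable_1) auto
  then have "set_integrable lborel {x..} (\<lambda>t. exp (- m * t))"
    by (simp add: set_integrable_def integrable_completion)
  then show "set_integrable lborel {x..} (\<lambda>t. x powr (-3/2) * exp (- m * t))"
    by simp
  show "set_borel_measurable lborel {x..} (\<lambda>t. exp (- (m * t)) * t powr (-3/2))"
    unfolding set_borel_measurable_def by measurable
  show "AE t in lborel. t \<in> {x..} \<longrightarrow> norm (exp (- (m * t)) * t powr (-3/2)) \<le> norm (x powr (-3/2) * exp (- m * t))"
    using assms by (auto simp: intro!: AE_I2 mult_right_mono powr_mono2')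
qed

lemma upper_Gamma_eq_LINT:
  "x > 0 \<Longrightarrow> upper_Gamma (-1/2) x = (LINT t:{x..}|lborel. exp (- t) * t powr (-3/2))"
  using set_borel_integral_eq_integral(2)[OF gamma_integrand_integrable[of x 1]]
  by (simp add: upper_Gamma_def)

lemma upper_Gamma_nonneg: "x > 0 \<Longrightarrow> upper_Gamma (-1/2) x \<ge> 0"
  by (subst upper_Gamma_eq_LINT) (simp_all add: set_lebesgue_integral_def)

text \<open>The substitution \<open>t = T * s\<close> produces the factor
  \<open>T * T powr (-3/2) = T powr (-1/2)\<close>, and
  \<open>exp (- (T * s)) \<le> exp (- s)\<close> because \<open>T \<ge> 1\<close>.\<close>

lemma upper_Gamma_scale_le:
  assumes "x > 0" "T \<ge> 1"
  shows "upper_Gamma (-1/2) (x * T) \<le> T powr (-1/2) * upper_Gamma (-1/2) x"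
proof -
  have T: "T > 0" "x * T > 0" using assms by auto
  have "upper_Gamma (-1/2) (x * T) = (LINT t|lborel. indicator {x * T..} t *\<^sub>R (exp (- t) * t powr (-3/2)))"
    using T by (subst upper_Gamma_eq_LINT) (simp_all add: set_lebesgue_integral_def)
  also have "\<dots> = \<bar>T\<bar> *\<^sub>R (LINT s|lborel. indicator {x * T..} (0 + T * s) *\<^sub>R (exp (- (0 + T * s)) * (0 + T * s) powr (-3/2)))"
    using T by (intro lborel_integral_real_affine) auto
  also have "(\<lambda>s. indicator {x * T..} (0 + T * s) *\<^sub>R (exp (- (0 + T * s)) * (0 + T * s) powr (-3/2)))
     = (\<lambda>s. T powr (-3/2) * (indicator {x..} s *\<^sub>R (exp (- (T * s)) * s powr (-3/2))))"
    using assms T by (auto simp: fun_eq_iff indicator_def powr_mult mult.commute)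
  also have "\<bar>T\<bar> *\<^sub>R (LINT s|lborel. T powr (-3/2) * (indicator {x..} s *\<^sub>R (exp (- (T * s)) * s powr (-3/2))))
     = (T * T powr (-3/2)) * (LINT s:{x..}|lborel. exp (- (T * s)) * s powr (-3/2))"
    using T by (simp add: set_lebesgue_integral_def)
  also have "T * T powr (-3/2) = T powr (-1/2)"
    using T powr_add[of T 1 "-3/2"] by simp
  also have "(LINT s:{x..}|lborel. exp (- (T * s)) * s powr (-3/2)) \<le> (LINT s:{x..}|lborel. exp (- (1 * s)) * s powr (-3/2))"
    using assms T
    by (intro set_integral_mono gamma_integrand_integrable) (auto intro!: mult_right_mono)
  also have "(LINT s:{x..}|lborel. exp (- (1 * s)) * s powr (-3/2)) = upper_Gamma (-1/2) x"
    using assms by (subst upper_Gamma_eq_LINT) simp_all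
  finally show ?thesis by (simp add: mult_left_mono)
qed

text \<open>Joins the constant term and the negative exponents into one family over all integers,
  with coefficients depending on the height. The value 0 for \<open>n > 0\<close> is set by hand,
  since \<open>Maass_expansion\<close> leaves \<open>am n\<close> arbitrary there.\<close>

definition Maass_nonhol_coeff :: "(int \<Rightarrow> complex) \<Rightarrow> int \<Rightarrow> real \<Rightarrow> complex" where
  "Maass_nonhol_coeff am n v =
     (if n = 0 then am 0 * of_real (v powr (-1/2))
      else if n < 0 then am n * of_real (upper_Gamma (-1/2) (4 * pi * \<bar>of_int n\<bar> * v)) else 0)"

text \<open>The power at \<open>n = 0\<close> scales exactly and the incomplete gamma values at
  least as fast. This uniform decay controls the limit at the cusp and also forces the vanishing in
  \<open>Maass_nonhol_coeff_eq_0\<close>.\<close>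

lemma norm_Maass_nonhol_coeff_le:
  assumes "v > 0" "T \<ge> 1"
  shows "norm (Maass_nonhol_coeff am n (v * T)) \<le> T powr (-1/2) * norm (Maass_nonhol_coeff am n v)"
proof -
  have *: "norm (Maass_nonhol_coeff am n (v * T)) \<le> T powr (-1/2) * norm (Maass_nonhol_coeff am n v)" if "n < 0"
  proof -
    have p: "4 * pi * \<bar>of_int n\<bar> * v > 0" using assms that by (intro mult_pos_pos) auto
    have p': "4 * pi * \<bar>of_int n\<bar> * v * T > 0" using p assms by simp
    show ?thesis
      using upper_Gamma_scale_le[OF p assms(2)] upper_Gamma_nonneg[OF p] upper_Gamma_nonneg[OF p'] that
        mult_left_mono[OF upper_Gamma_scale_le[OF p assms(2)], of "norm (am n)"]
      by (simp add: Maass_nonhol_coeff_def norm_mult mult_ac)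
  qed
  consider "n < 0" | "n = 0" | "n > 0" by linarith
  then show ?thesis
    by cases (use * assms in \<open>auto simp: Maass_nonhol_coeff_def norm_mult powr_mult mult_ac\<close>)
qed

lemma Maass_expansion_has_sum:
  assumes "Maass_expansion g ap am" "\<tau> \<in> uhp"
  shows "((\<lambda>n. (ap n + Maass_nonhol_coeff am n (Im \<tau>)) * e (of_int n * \<tau>)) has_sum g \<tau>) UNIV"
    and "(\<lambda>n. ap n * e (of_int n * \<tau>)) summable_on UNIV"
    and "(\<lambda>n. Maass_nonhol_coeff am n (Im \<tau>) * e (of_int n * \<tau>)) summable_on UNIV"
proof -
  let ?\<delta> = "\<lambda>n. Maass_nonhol_coeff am n (Im \<tau>)"
  obtain gp gm where gp: "((\<lambda>n. ap n * e (of_int n * \<tau>)) has_sum gp) UNIV"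
    and gm: "((\<lambda>n. am n * of_real (upper_Gamma (-1/2) (4 * pi * \<bar>of_int n\<bar> * Im \<tau>))
               * e (of_int n * \<tau>)) has_sum gm) {..<0}"
    and g: "g \<tau> = gp + (am 0 * of_real (Im \<tau> powr (-1/2)) + gm)"
    using assms unfolding Maass_expansion_def by blast
  have "((\<lambda>n. ?\<delta> n * e (of_int n * \<tau>)) has_sum gm) {..<0}"
    using gm by (rule has_sum_cong[THEN iffD1, rotated]) (simp add: Maass_nonhol_coeff_def)
  moreover have "((\<lambda>n. ?\<delta> n * e (of_int n * \<tau>)) has_sum (am 0 * of_real (Im \<tau> powr (-1/2)))) {0}"
    by (rule has_sum_finiteI) (auto simp: Maass_nonhol_coeff_def)
  ultimately have "((\<lambda>n. ?\<delta> n * e (of_int n * \<tau>)) has_sum (am 0 * of_real (Im \<tau> powr (-1/2)) + gm)) ({0} \<union> {..<0})"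
    by (intro has_sum_Un_disjoint) auto
  then have \<delta>: "((\<lambda>n. ?\<delta> n * e (of_int n * \<tau>)) has_sum (am 0 * of_real (Im \<tau> powr (-1/2)) + gm)) UNIV"
    by (rule has_sum_cong_neutral[THEN iffD1, rotated -1]) (auto simp: Maass_nonhol_coeff_def)
  show "((\<lambda>n. (ap n + ?\<delta> n) * e (of_int n * \<tau>)) has_sum g \<tau>) UNIV"
    using has_sum_add[OF gp \<delta>] by (simp add: g distrib_right)
  show "(\<lambda>n. ap n * e (of_int n * \<tau>)) summable_on UNIV" "(\<lambda>n. ?\<delta> n * e (of_int n * \<tau>)) summable_on UNIV"
    using gp \<delta> by (auto intro: has_sum_imp_summable)
qed


section \<open>Green's theorem on the truncated fundamental domain\<close>

lemma measurable_Complex: "(\<lambda>(x, y). Complex x y) \<in> lborel \<Otimes>\<^sub>M lborel \<rightarrow>\<^sub>M (borel :: complex measure)"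
proof -
  have "(\<lambda>p. Complex (fst p) (snd p)) \<in> borel_measurable borel"
    by (intro borel_measurable_continuous_onI continuous_intros)
  then show ?thesis unfolding lborel_prod case_prod_unfold by simp
qed

text \<open>Lebesgue measure is determined by its values on boxes, and \<open>Complex\<close> pulls
  a box back to a box of the same area. This makes Fubini available in the coordinates
  \<open>u\<close> and \<open>v\<close>.\<close>

lemma lborel_complex: "(lborel :: complex measure) = distr (lborel \<Otimes>\<^sub>M lborel) borel (\<lambda>(x, y). Complex x y)"
proof (rule lborel_eqI)
  fix l u :: complex
  assume le: "\<And>b. b \<in> Basis \<Longrightarrow> l \<bullet> b \<le> u \<bullet> b"
  have "(\<lambda>(x, y). Complex x y) -` box l u \<inter> space (lborel \<Otimes>\<^sub>M lborel) = box (Re l, Im l) (Re u, Im u)"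
    by (auto simp: box_def Basis_complex_def Basis_prod_def space_pair_measure)
  then show "emeasure (distr (lborel \<Otimes>\<^sub>M lborel) borel (\<lambda>(x, y). Complex x y)) (box l u)
      = ennreal (\<Prod>b\<in>Basis. (u - l) \<bullet> b)"
    using le[of 1] le[of \<i>]
    by (subst emeasure_distr[OF measurable_Complex])
       (simp_all add: lborel_prod emeasure_lborel_box_eq Basis_complex_def Basis_prod_def prod.union_disjoint)
qed simp

lemma arc_height:
  fixes u :: real
  assumes "\<bar>u\<bar> \<le> 1/2"
  shows "0 < 1 - u\<^sup>2" "0 < sqrt (1 - u\<^sup>2)" "sqrt (1 - u\<^sup>2) \<le> 1" "(sqrt (1 - u\<^sup>2))\<^sup>2 = 1 - u\<^sup>2"
proof -
  have "u\<^sup>2 \<le> (1/2)\<^sup>2" using assms by (subst abs_le_square_iff[symmetric]) simp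
  then show "0 < 1 - u\<^sup>2" by (simp add: power2_eq_square)
  then show "0 < sqrt (1 - u\<^sup>2)" "sqrt (1 - u\<^sup>2) \<le> 1" "(sqrt (1 - u\<^sup>2))\<^sup>2 = 1 - u\<^sup>2" by auto
qed

lemma truncated_fundamental_domain_iff:
  "Complex u v \<in> truncated_fundamental_domain T \<longleftrightarrow> \<bar>u\<bar> \<le> 1/2 \<and> sqrt (1 - u\<^sup>2) \<le> v \<and> v \<le> T"
proof (cases "\<bar>u\<bar> \<le> 1/2")
  case True
  note h = arc_height[OF True]
  have "v > 0 \<and> 1 \<le> norm (Complex u v) \<longleftrightarrow> sqrt (1 - u\<^sup>2) \<le> v"
  proof
    assume "v > 0 \<and> 1 \<le> norm (Complex u v)"
    then show "sqrt (1 - u\<^sup>2) \<le> v" by (intro real_le_lsqrt) (auto simp: complex_norm)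
  next
    assume *: "sqrt (1 - u\<^sup>2) \<le> v"
    then have "(sqrt (1 - u\<^sup>2))\<^sup>2 \<le> v\<^sup>2" using h by (intro power_mono) auto
    then show "v > 0 \<and> 1 \<le> norm (Complex u v)" using h less_le_trans[OF h(2) *] by (auto simp: complex_norm)
  qed
  then show ?thesis using True by (auto simp: truncated_fundamental_domain_def uhp_def)
qed (auto simp: truncated_fundamental_domain_def)

lemma compact_truncated_fundamental_domain: "compact (truncated_fundamental_domain T)"
proof -
  have "truncated_fundamental_domain T = {\<tau>. \<bar>Re \<tau>\<bar> \<le> 1/2} \<inter> {\<tau>. norm \<tau> \<ge> 1} \<inter> {\<tau>. 0 \<le> Im \<tau>} \<inter> {\<tau>. Im \<tau> \<le> T}"
  proof -
    \<comment> \<open>A real point of the strip has norm at most 1/2, so the strict inequality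
      defining \<open>uhp\<close> can be replaced by a closed condition.\<close>
    have "Im \<tau> > 0" if "\<bar>Re \<tau>\<bar> \<le> 1/2" "1 \<le> norm \<tau>" "0 \<le> Im \<tau>" for \<tau>
      using that cmod_le[of \<tau>] by linarith
    then show ?thesis by (auto simp: truncated_fundamental_domain_def uhp_def)
  qed
  moreover have "closed ({\<tau>. \<bar>Re \<tau>\<bar> \<le> 1/2} \<inter> {\<tau>. norm \<tau> \<ge> 1} \<inter> {\<tau>. 0 \<le> Im \<tau>} \<inter> {\<tau>. Im \<tau> \<le> T})"
    by (intro closed_Int closed_Collect_le continuous_intros)
  moreover have "bounded (truncated_fundamental_domain T)"
  proof (rule boundedI)
    fix \<tau> assume "\<tau> \<in> truncated_fundamental_domain T"
    then show "norm \<tau> \<le> 1/2 + T"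
      using cmod_le[of \<tau>] by (auto simp: truncated_fundamental_domain_def uhp_def)
  qed
  ultimately show ?thesis by (simp add: compact_eq_bounded_closed)
qed

lemma integral_truncated_fundamental_domain:
  fixes k :: "complex \<Rightarrow> complex"
  assumes "continuous_on uhp k"
  shows "(LINT \<tau>:truncated_fundamental_domain T|lborel. k \<tau>) =
     integral {-1/2..1/2} (\<lambda>u. integral {sqrt (1 - u\<^sup>2)..T} (\<lambda>v. k (Complex u v)))"
proof -
  let ?F = "truncated_fundamental_domain T"
  define f where "f = (\<lambda>\<tau>. indicator ?F \<tau> *\<^sub>R k \<tau>)"
  have "continuous_on ?F k"
    using assms by (rule continuous_on_subset) (auto simp: truncated_fundamental_domain_def)
  from borel_integrable_compact[OF compact_truncated_fundamental_domain this]
  have int_f: "integrable lborel f" by (simp add: f_def)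
  then have fm: "f \<in> borel_measurable borel" by auto
  have int2: "integrable (lborel \<Otimes>\<^sub>M lborel) (\<lambda>p. f (case p of (x, y) \<Rightarrow> Complex x y))"
    using int_f unfolding lborel_complex by (subst (asm) integrable_distr_eq[OF measurable_Complex fm])
  define I where "I = (\<lambda>u. integral {sqrt (1 - u\<^sup>2)..T} (\<lambda>v. k (Complex u v)))"
  have inner: "(LINT v|lborel. f (Complex u v)) = indicator {-1/2..1/2} u *\<^sub>R I u" for u
  proof (cases "\<bar>u\<bar> \<le> 1/2")
    case True
    have "continuous_on {sqrt (1 - u\<^sup>2)..T} (\<lambda>v. k (Complex u v))"
      using less_le_trans[OF arc_height(2)[OF True]]
      by (intro continuous_on_compose2[OF assms] continuous_intros) (auto simp: uhp_def)
    then have si: "set_integrable lborel {sqrt (1 - u\<^sup>2)..T} (\<lambda>v. k (Complex u v))"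
      unfolding set_integrable_def by (intro borel_integrable_compact) auto
    have "(LINT v|lborel. f (Complex u v)) = (LINT v:{sqrt (1 - u\<^sup>2)..T}|lborel. k (Complex u v))"
      unfolding set_lebesgue_integral_def using True
      by (intro Bochner_Integration.integral_cong refl)
         (auto simp: f_def indicator_def truncated_fundamental_domain_iff)
    also have "\<dots> = I u" using set_borel_integral_eq_integral(2)[OF si] by (simp add: I_def)
    finally show ?thesis using True by (auto simp: indicator_def)
  next
    case False
    then have "(\<lambda>v. f (Complex u v)) = (\<lambda>_. 0)"
      by (auto simp: f_def truncated_fundamental_domain_iff)
    moreover have "u \<notin> {-1/2..1/2}" using False by auto
    ultimately show ?thesis by simp
  qed
  have "(LINT \<tau>:?F|lborel. k \<tau>) = (LINT p|(lborel \<Otimes>\<^sub>M lborel). f (case p of (x, y) \<Rightarrow> Complex x y))"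
    unfolding set_lebesgue_integral_def f_def[symmetric]
    by (subst lborel_complex, subst integral_distr[OF measurable_Complex fm]) simp
  also have "\<dots> = (LINT u|lborel. LINT v|lborel. f (Complex u v))"
    using lborel_pair.integral_fst'[OF int2] by simp
  also have "\<dots> = (LINT u:{-1/2..1/2}|lborel. I u)"
    unfolding inner set_lebesgue_integral_def ..
  also have "\<dots> = integral {-1/2..1/2} I"
  proof (rule set_borel_integral_eq_integral)
    show "set_integrable lborel {-1/2..1/2} I"
      using lborel_pair.integrable_fst'[OF int2] unfolding set_integrable_def by (simp add: inner)
  qed
  finally show ?thesis by (simp add: I_def)
qed

section \<open>The boundary of the truncated domain\<close>

lemma integral_odd_eq_0:
  fixes f :: "real \<Rightarrow> complex"
  assumes "\<And>u. u \<in> {-a..a} \<Longrightarrow> f (- u) = - f u"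
  shows "integral {-a..a} f = 0"
proof -
  have "integral {-a..a} f = integral {-a..a} (\<lambda>u. f (- u))"
    using Henstock_Kurzweil_Integration.integral_reflect_real[of a "-a" f] by simp
  also have "\<dots> = integral {-a..a} (\<lambda>u. - f u)"
    by (intro integral_cong assms)
  finally show ?thesis by simp
qed

text \<open>Integrating \<open>Hv\<close> upwards gives values of \<open>H\<close> on the top edge
  and on the arc. Integrating \<open>Hu\<close> over vertical segments gives a derivative in
  \<open>u\<close> plus an arc term; the derivative integrates to 0 because \<open>per\<close>
  identifies the two vertical sides. The combined arc integrand is odd in \<open>u\<close> by
  \<open>inv\<close>, so only the top edge remains.\<close>

lemma green_truncated_fundamental_domain:
  fixes H Hu Hv :: "complex \<Rightarrow> complex"
  assumes der: "\<And>\<tau>. \<tau> \<in> uhp \<Longrightarrow>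
      (H has_derivative (\<lambda>h. of_real (Re h) * Hu \<tau> + of_real (Im h) * Hv \<tau>)) (at \<tau>)"
    and cont: "continuous_on uhp Hu" "continuous_on uhp Hv"
    and per: "\<And>\<tau>. \<tau> \<in> uhp \<Longrightarrow> H (\<tau> + 1) = H \<tau>"
    and inv: "\<And>\<tau>. \<tau> \<in> uhp \<Longrightarrow> H (- 1 / \<tau>) = \<tau>\<^sup>2 * H \<tau>"
    and T: "T \<ge> 1"
  shows "(LINT \<tau>:truncated_fundamental_domain T|lborel. Hu \<tau> + \<i> * Hv \<tau>)
      = \<i> * integral {-1/2..1/2} (\<lambda>u. H (Complex u T))"
proof -
  define \<phi> where "\<phi> = (\<lambda>u::real. sqrt (1 - u\<^sup>2))"
  define \<phi>' where "\<phi>' = (\<lambda>u::real. - u / \<phi> u)"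
  \<comment> \<open>Straightens the domain to a rectangle, so that the Leibniz rule applies with
    fixed limits instead of the moving lower limit \<open>\<phi> u\<close>.\<close>
  define X where "X = (\<lambda>u s. Complex u (\<phi> u + s * (T - \<phi> u)))"
  define I where "I = {-1/2..1/2::real}"
  have I_abs: "\<bar>u\<bar> \<le> 1/2" if "u \<in> I" for u
    using that by (auto simp: I_def)
  have \<phi>: "0 < \<phi> u" "\<phi> u \<le> 1" "\<phi> u \<le> T" "(\<phi> u)\<^sup>2 = 1 - u\<^sup>2" if "u \<in> I" for u
  proof -
    from arc_height[OF I_abs[OF that]] show "0 < \<phi> u" "\<phi> u \<le> 1" "\<phi> u \<le> T" "(\<phi> u)\<^sup>2 = 1 - u\<^sup>2"
      using T by (simp_all only: \<phi>_def)
  qed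
  have \<phi>_der: "(\<phi> has_real_derivative \<phi>' u) (at u within A)" if "u \<in> I" for u A
    using arc_height[of u] I_abs[OF that] unfolding \<phi>'_def \<phi>_def
    by (auto intro!: derivative_eq_intros simp: field_simps)
  have \<phi>_cont: "continuous_on I \<phi>" unfolding \<phi>_def by (intro continuous_intros)
  have \<phi>'_cont: "continuous_on I \<phi>'"
    unfolding \<phi>'_def using \<phi> by (intro continuous_intros \<phi>_cont) force
  have Ht: "continuous_on uhp H"
    using der has_derivative_continuous by (fastforce intro: continuous_at_imp_continuous_on)
  have X_uhp: "X u s \<in> uhp" if "u \<in> I" "s \<in> {0..1}" for u s
    using \<phi>[OF that(1)] that(2) by (auto simp: X_def uhp_def intro!: add_pos_nonneg mult_nonneg_nonneg)
  have curve: "((\<lambda>t. H (\<gamma> t)) has_vector_derivative of_real a * Hu (\<gamma> t) + of_real b * Hv (\<gamma> t)) (at t within A)"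
    if "(\<gamma> has_vector_derivative Complex a b) (at t within A)" "\<gamma> t \<in> uhp" for \<gamma> a b t A
    using vector_derivative_diff_chain_within[OF that(1) has_derivative_at_withinI[OF der[OF that(2)]]]
    by (simp add: o_def)
  have subst: "integral {\<phi> u..T} (\<lambda>v. K (Complex u v)) = integral {0..1} (\<lambda>s. of_real (T - \<phi> u) * K (X u s))"
    if "u \<in> I" "continuous_on uhp K" for u and K :: "complex \<Rightarrow> complex"
  proof -
    have "((\<lambda>s. (T - \<phi> u) *\<^sub>R K (Complex u (\<phi> u + s * (T - \<phi> u)))) has_integral
       integral {\<phi> u + 0 * (T - \<phi> u)..\<phi> u + 1 * (T - \<phi> u)} (\<lambda>v. K (Complex u v))) {0..1}"
    proof (rule has_integral_substitution)
      show "(\<lambda>s. \<phi> u + s * (T - \<phi> u)) ` {0..1} \<subseteq> {\<phi> u..T}"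
        using \<phi>[OF that(1)] mult_left_le_one_le[of "T - \<phi> u"] by (auto intro!: mult_nonneg_nonneg) (smt (verit))
      show "continuous_on {\<phi> u..T} (\<lambda>v. K (Complex u v))"
        using \<phi>[OF that(1)] by (intro continuous_on_compose2[OF that(2)] continuous_intros) (auto simp: uhp_def)
      show "((\<lambda>s. \<phi> u + s * (T - \<phi> u)) has_real_derivative T - \<phi> u) (at s within {0..1})" for s
        by (auto intro!: derivative_eq_intros)
    qed (use \<phi>[OF that(1)] in auto)
    from integral_unique[OF this] show ?thesis by (simp add: X_def scaleR_conv_of_real)
  qed
  \<comment> \<open>This is the integral of \<open>H\<close> along the vertical segment at
    \<open>u\<close>, after the substitution.\<close>
  define P where "P = (\<lambda>u. integral {0..1} (\<lambda>s. of_real (T - \<phi> u) * H (X u s)))"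
  define P' where "P' = (\<lambda>u s. of_real (T - \<phi> u) * (Hu (X u s) + of_real ((1 - s) * \<phi>' u) * Hv (X u s))
       - of_real (\<phi>' u) * H (X u s))"
  have X_cont: "continuous_on (I \<times> {0..1}) (\<lambda>(u, s). X u s)"
    unfolding X_def case_prod_unfold
    by (intro continuous_intros continuous_on_compose2[OF \<phi>_cont]) auto
  have comp_cont: "continuous_on (I \<times> {0..1}) (\<lambda>(u, s). K (X u s))" if "continuous_on uhp K" for K :: "complex \<Rightarrow> complex"
  proof -
    have "(\<lambda>(u, s). X u s) ` (I \<times> {0..1}) \<subseteq> uhp" using X_uhp by auto
    from continuous_on_compose2[OF that X_cont this] show ?thesis by (simp add: case_prod_unfold)
  qed
  have comp_cont1: "continuous_on {0..1} (\<lambda>s. K (X u s))" if "continuous_on uhp K" "u \<in> I" for K :: "complex \<Rightarrow> complex" and u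
    using that unfolding X_def
    by (intro continuous_on_compose2[OF that(1)] continuous_intros) (use X_uhp in \<open>auto simp: X_def\<close>)
  have P_der: "(P has_vector_derivative integral {0..1} (P' u)) (at u within I)" if "u \<in> I" for u
  proof -
    have "((\<lambda>u. integral (cbox 0 1) (\<lambda>s. of_real (T - \<phi> u) * H (X u s))) has_vector_derivative
        integral (cbox 0 1) (P' u)) (at u within I)"
    proof (rule leibniz_rule_vector_derivative)
      fix u s :: real assume us: "u \<in> I" "s \<in> cbox 0 1"
      have eq: "X t s = of_real t + \<i> * of_real (\<phi> t + s * (T - \<phi> t))" for t
        by (simp add: X_def complex_eq_iff)
      have "((\<lambda>u. X u s) has_vector_derivative of_real 1 + \<i> * of_real (\<phi>' u + s * (0 - \<phi>' u))) (at u within I)"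
        unfolding eq
        by (intro has_vector_derivative_add has_vector_derivative_mult_right has_vector_derivative_of_real)
           (auto intro!: derivative_eq_intros \<phi>_der us)
      also have "of_real 1 + \<i> * of_real (\<phi>' u + s * (0 - \<phi>' u)) = Complex 1 ((1 - s) * \<phi>' u)"
        by (simp add: complex_eq_iff algebra_simps)
      finally have "((\<lambda>u. H (X u s)) has_vector_derivative of_real 1 * Hu (X u s) + of_real ((1 - s) * \<phi>' u) * Hv (X u s)) (at u within I)"
        by (rule curve) (use us X_uhp in auto)
      moreover have "((\<lambda>u. complex_of_real (T - \<phi> u)) has_vector_derivative of_real (0 - \<phi>' u)) (at u within I)"
        by (intro has_vector_derivative_of_real) (auto intro!: derivative_eq_intros \<phi>_der us)
      ultimately have "((\<lambda>u. of_real (T - \<phi> u) * H (X u s)) has_vector_derivative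
         of_real (T - \<phi> u) * (of_real 1 * Hu (X u s) + of_real ((1 - s) * \<phi>' u) * Hv (X u s))
         + of_real (0 - \<phi>' u) * H (X u s)) (at u within I)"
        by (rule has_vector_derivative_mult[rotated])
      then show "((\<lambda>u. of_real (T - \<phi> u) * H (X u s)) has_vector_derivative P' u s) (at u within I)"
        by (simp add: P'_def)
    next
      show "continuous_on (I \<times> cbox 0 1) (\<lambda>(u, s). P' u s)"
        using comp_cont[OF cont(1)] comp_cont[OF cont(2)] comp_cont[OF Ht]
        unfolding P'_def case_prod_unfold
        by (auto intro!: continuous_intros continuous_on_compose2[OF \<phi>_cont] continuous_on_compose2[OF \<phi>'_cont])
    next
      fix u assume "u \<in> I"
      then show "(\<lambda>s. of_real (T - \<phi> u) * H (X u s)) integrable_on cbox 0 1"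
        unfolding interval_cbox[symmetric]
        by (intro integrable_continuous_interval continuous_intros comp_cont1 Ht)
    qed (use that in \<open>auto simp: I_def\<close>)
    then show ?thesis by (simp add: P_def)
  qed
  have X1: "X u 1 = Complex u T" and X0: "X u 0 = Complex u (\<phi> u)" for u
    by (simp_all add: X_def)
  have P'_eq: "integral {0..1} (P' u) = integral {\<phi> u..T} (\<lambda>v. Hu (Complex u v)) - of_real (\<phi>' u) * H (Complex u (\<phi> u))"
    if u: "u \<in> I" for u
  proof -
    have X_der: "((\<lambda>s. X u s) has_vector_derivative Complex 0 (T - \<phi> u)) (at s within {0..1})" for s
    proof -
      have eq: "X u s = of_real u + \<i> * of_real (\<phi> u + s * (T - \<phi> u))" for s
        by (simp add: X_def complex_eq_iff)
      have "((\<lambda>s. X u s) has_vector_derivative 0 + \<i> * of_real (0 + 1 * (T - \<phi> u))) (at s within {0..1})"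
        unfolding eq
        by (intro has_vector_derivative_add has_vector_derivative_mult_right has_vector_derivative_of_real
            has_vector_derivative_const) (auto intro!: derivative_eq_intros)
      moreover have "0 + \<i> * of_real (0 + 1 * (T - \<phi> u)) = Complex 0 (T - \<phi> u)" by (simp add: complex_eq_iff)
      ultimately show ?thesis by simp
    qed
    \<comment> \<open>The derivative of \<open>(1 - s) * H (X u s)\<close> in \<open>s\<close>. It
      collects the terms of \<open>P'\<close> carrying the factor \<open>\<phi>' u\<close>, which
      therefore integrate to a value of \<open>H\<close> on the arc.\<close>
    define q where "q = (\<lambda>s. of_real (1 - s) * (of_real (T - \<phi> u) * Hv (X u s)) - H (X u s))"
    have "(q has_integral (of_real (1 - 1) * H (X u 1) - of_real (1 - 0) * H (X u 0))) {0..1}"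
    proof (rule fundamental_theorem_of_calculus)
      fix s :: real assume s: "s \<in> {0..1}"
      have "((\<lambda>s. H (X u s)) has_vector_derivative of_real 0 * Hu (X u s) + of_real (T - \<phi> u) * Hv (X u s)) (at s within {0..1})"
        by (rule curve[OF X_der X_uhp[OF u s]])
      moreover have "((\<lambda>s. complex_of_real (1 - s)) has_vector_derivative of_real (0 - 1)) (at s within {0..1})"
        by (intro has_vector_derivative_of_real) (auto intro!: derivative_eq_intros)
      ultimately have "((\<lambda>s. of_real (1 - s) * H (X u s)) has_vector_derivative
          of_real (1 - s) * (of_real 0 * Hu (X u s) + of_real (T - \<phi> u) * Hv (X u s)) + of_real (0 - 1) * H (X u s)) (at s within {0..1})"
        by (rule has_vector_derivative_mult[rotated])
      then show "((\<lambda>s. of_real (1 - s) * H (X u s)) has_vector_derivative q s) (at s within {0..1})"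
        by (simp add: q_def)
    qed simp
    then have q: "(q has_integral - H (Complex u (\<phi> u))) {0..1}" by (simp add: X0)
    have "((\<lambda>s. of_real (T - \<phi> u) * Hu (X u s)) has_integral integral {\<phi> u..T} (\<lambda>v. Hu (Complex u v))) {0..1}"
      unfolding subst[OF u cont(1)]
      by (intro integrable_integral integrable_continuous_interval continuous_intros comp_cont1 cont u)
    from has_integral_add[OF this has_integral_mult_right[OF q, of "of_real (\<phi>' u)"]]
    have "((\<lambda>s. of_real (T - \<phi> u) * Hu (X u s) + of_real (\<phi>' u) * q s) has_integral
       integral {\<phi> u..T} (\<lambda>v. Hu (Complex u v)) + of_real (\<phi>' u) * - H (Complex u (\<phi> u))) {0..1}" .
    also have "(\<lambda>s. of_real (T - \<phi> u) * Hu (X u s) + of_real (\<phi>' u) * q s) = P' u"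
      by (simp add: fun_eq_iff P'_def q_def algebra_simps)
    finally show ?thesis by (simp add: integral_unique)
  qed
  have "((\<lambda>u. integral {0..1} (P' u)) has_integral P (1/2) - P (-1/2)) I"
    unfolding I_def by (rule fundamental_theorem_of_calculus) (use P_der in \<open>auto simp: I_def\<close>)
  moreover have "P (1/2) = P (-1/2)"
  proof -
    have "H (X (1/2) s) = H (X (-1/2) s)" if "s \<in> {0..1}" for s
    proof -
      have "X (1/2) s = X (-1/2) s + 1" by (simp add: X_def \<phi>_def complex_eq_iff)
      then show ?thesis using per[OF X_uhp[of "-1/2" s]] that by (simp add: I_def)
    qed
    moreover have "\<phi> (1/2) = \<phi> (-1/2)" by (simp add: \<phi>_def)
    ultimately show ?thesis unfolding P_def by (intro integral_cong) simp
  qed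
  ultimately have i1: "((\<lambda>u. integral {0..1} (P' u)) has_integral 0) I" by simp
  \<comment> \<open>Since \<open>\<phi>' u - \<i>\<close> is \<open>- \<i>\<close> times the
    velocity \<open>1 + \<i> * \<phi>' u\<close> of the arc, the integral of \<open>A\<close> is the
    contribution of the arc.\<close>
  define A where "A = (\<lambda>u. (of_real (\<phi>' u) - \<i>) * H (Complex u (\<phi> u)))"
  have A_cont: "continuous_on I A"
    unfolding A_def using \<phi>
    by (intro continuous_intros \<phi>'_cont continuous_on_compose2[OF Ht] \<phi>_cont) (auto simp: uhp_def)
  have "integral {-(1/2)..1/2} A = 0"
  proof (rule integral_odd_eq_0)
    fix u :: real assume "u \<in> {-(1/2)..1/2}"
    then have u: "u \<in> I" by (simp add: I_def)
    define z where "z = Complex u (\<phi> u)"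
    have z: "z \<in> uhp" using \<phi>[OF u] by (simp add: z_def uhp_def)
    have zc: "z * cnj z = 1"
      using \<phi>[OF u] by (simp add: z_def complex_eq_iff power2_eq_square)
    then have "z \<noteq> 0" by auto
    \<comment> \<open>On the unit circle inversion is reflection in the imaginary axis, so
      \<open>inv\<close> relates the two halves of the arc.\<close>
    then have "- cnj z = - 1 / z" using zc by (simp add: field_simps)
    moreover have "Complex (- u) (\<phi> (- u)) = - cnj z" by (simp add: z_def \<phi>_def complex_eq_iff)
    ultimately have Hz: "H (Complex (- u) (\<phi> (- u))) = z\<^sup>2 * H z" using inv[OF z] by simp
    \<comment> \<open>The velocity factor is proportional to \<open>z\<close> here and to
      \<open>cnj z\<close> at the reflected point; with the \<open>z\<^sup>2\<close> from
      \<open>inv\<close> and \<open>z * cnj z = 1\<close> this makes \<open>A\<close> odd.\<close>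
    have f1: "of_real (\<phi>' u) - \<i> = - z / of_real (\<phi> u)" if "u \<in> I" "z = Complex u (\<phi> u)" for u z
      using \<phi>[OF that(1)] that(2) by (simp add: \<phi>'_def complex_eq_iff field_simps)
    have "of_real (\<phi>' (- u)) - \<i> = cnj z / of_real (\<phi> u)"
      using \<phi>[OF u] by (simp add: \<phi>'_def \<phi>_def z_def complex_eq_iff field_simps)
    moreover have "of_real (\<phi>' u) - \<i> = - z / of_real (\<phi> u)" by (rule f1[OF u z_def])
    moreover have "cnj z / of_real (\<phi> u) * (z\<^sup>2 * H z) = (z * cnj z) * z / of_real (\<phi> u) * H z"
      by (simp add: power2_eq_square mult_ac)
    ultimately show "A (- u) = - A u"
      unfolding A_def Hz by (simp add: zc z_def[symmetric])
  qed
  then have i2: "(A has_integral 0) I"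
    using integrable_integral[OF integrable_continuous_interval[OF A_cont[unfolded I_def]]] by (simp add: I_def)
  have "continuous_on I (\<lambda>u. H (Complex u T))"
    using T by (intro continuous_on_compose2[OF Ht] continuous_intros) (auto simp: uhp_def)
  then have i3: "((\<lambda>u. \<i> * H (Complex u T)) has_integral \<i> * integral I (\<lambda>u. H (Complex u T))) I"
    unfolding I_def by (intro has_integral_mult_right integrable_integral integrable_continuous_interval)
  have inner: "integral {\<phi> u..T} (\<lambda>v. Hu (Complex u v) + \<i> * Hv (Complex u v))
     = integral {0..1} (P' u) + (A u + \<i> * H (Complex u T))" if u: "u \<in> I" for u
  proof -
    have Kc: "continuous_on {\<phi> u..T} (\<lambda>v. K (Complex u v))" if "continuous_on uhp K" for K :: "complex \<Rightarrow> complex"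
      using \<phi>[OF u] by (intro continuous_on_compose2[OF that] continuous_intros) (auto simp: uhp_def)
    have "((\<lambda>v. Hv (Complex u v)) has_integral H (Complex u T) - H (Complex u (\<phi> u))) {\<phi> u..T}"
    proof (rule fundamental_theorem_of_calculus[OF \<phi>(3)[OF u]])
      fix v assume v: "v \<in> {\<phi> u..T}"
      have eq: "Complex u v = of_real u + \<i> * of_real v" for v
        by (simp add: complex_eq_iff)
      have "((\<lambda>v. Complex u v) has_vector_derivative 0 + \<i> * of_real 1) (at v within {\<phi> u..T})"
        unfolding eq
        by (intro has_vector_derivative_add has_vector_derivative_mult_right has_vector_derivative_of_real
            has_vector_derivative_const) (auto intro!: derivative_eq_intros)
      also have "0 + \<i> * of_real 1 = Complex 0 1" by (simp add: complex_eq_iff)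
      finally have "((\<lambda>v. H (Complex u v)) has_vector_derivative of_real 0 * Hu (Complex u v) + of_real 1 * Hv (Complex u v)) (at v within {\<phi> u..T})"
        by (rule curve) (use v \<phi>[OF u] in \<open>auto simp: uhp_def\<close>)
      then show "((\<lambda>v. H (Complex u v)) has_vector_derivative Hv (Complex u v)) (at v within {\<phi> u..T})" by simp
    qed
    from has_integral_mult_right[OF this, of \<i>]
    have "((\<lambda>v. \<i> * Hv (Complex u v)) has_integral \<i> * (H (Complex u T) - H (Complex u (\<phi> u)))) {\<phi> u..T}" .
    from integral_unique[OF has_integral_add[OF integrable_integral[OF integrable_continuous_interval[OF Kc[OF cont(1)]]] this]]
    show ?thesis unfolding P'_eq[OF u] A_def by (simp add: algebra_simps)
  qed
  have "(LINT \<tau>:truncated_fundamental_domain T|lborel. Hu \<tau> + \<i> * Hv \<tau>)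
     = integral I (\<lambda>u. integral {\<phi> u..T} (\<lambda>v. Hu (Complex u v) + \<i> * Hv (Complex u v)))"
    unfolding I_def \<phi>_def by (intro integral_truncated_fundamental_domain continuous_intros cont)
  also have "\<dots> = integral I (\<lambda>u. integral {0..1} (P' u) + (A u + \<i> * H (Complex u T)))"
    by (intro integral_cong inner)
  also have "\<dots> = \<i> * integral I (\<lambda>u. H (Complex u T))"
    using has_integral_add[OF i1 has_integral_add[OF i2 i3]] by (simp add: integral_unique)
  finally show ?thesis by (simp add: I_def)
qed


section \<open>The non-holomorphic part satisfies the plus condition\<close>

lemma e_diff_of_int [simp]: "e (x - of_int n) = e x"
  using e_add[of x "of_int (- n)"] e_of_int[of "- n"] by (simp del: e_of_int)

lemma has_vector_derivative_comp_holomorphic: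
  assumes "K holomorphic_on uhp" "\<gamma> t \<in> uhp" "(\<gamma> has_vector_derivative d) (at t within A)"
  shows "((\<lambda>t. K (\<gamma> t)) has_vector_derivative d * deriv K (\<gamma> t)) (at t within A)"
proof -
  have "(K has_field_derivative deriv K (\<gamma> t)) (at (\<gamma> t) within \<gamma> ` A)"
    using holomorphic_derivI[OF assms(1) open_uhp assms(2)] by (rule has_field_derivative_at_within)
  from field_vector_diff_chain_within[OF assms(3) this] show ?thesis by (simp add: o_def)
qed

text \<open>The derivative in \<open>v\<close> of the integral is \<open>i\<close> times the integral of \<open>K'\<close>, which vanishes by periodicity.\<close>

lemma integral_periodic_holomorphic:
  assumes hol: "K holomorphic_on uhp" and per: "\<And>\<tau>. \<tau> \<in> uhp \<Longrightarrow> K (\<tau> + 1) = K \<tau>"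
    and "v > 0" "w > 0"
  shows "integral {-1/2..1/2} (\<lambda>u. K (Complex u v)) = integral {-1/2..1/2} (\<lambda>u. K (Complex u w))"
proof -
  have C: "Complex u v = of_real u + \<i> * of_real v" for u v
    by (simp add: complex_eq_iff)
  have cont: "continuous_on uhp K" "continuous_on uhp (deriv K)"
    using hol holomorphic_deriv[OF hol open_uhp] by (auto intro: holomorphic_on_imp_continuous_on)
  have "((\<lambda>v. integral (cbox (-1/2) (1/2)) (\<lambda>u. K (Complex u v))) has_vector_derivative 0) (at v0 within {0<..})"
    if v0: "v0 \<in> {0<..}" for v0
  proof -
    have "((\<lambda>v. integral (cbox (-1/2) (1/2)) (\<lambda>u. K (Complex u v))) has_vector_derivative
       integral (cbox (-1/2) (1/2)) (\<lambda>u. \<i> * deriv K (Complex u v0))) (at v0 within {0<..})"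
    proof (rule leibniz_rule_vector_derivative)
      fix v u :: real assume v: "v \<in> {0<..}"
      have "((\<lambda>v. Complex u v) has_vector_derivative 0 + \<i> * of_real 1) (at v within {0<..})"
        unfolding C
        by (intro has_vector_derivative_add has_vector_derivative_mult_right has_vector_derivative_of_real
            has_vector_derivative_const) (auto intro!: derivative_eq_intros)
      from has_vector_derivative_comp_holomorphic[OF hol _ this] v
      show "((\<lambda>v. K (Complex u v)) has_vector_derivative \<i> * deriv K (Complex u v)) (at v within {0<..})"
        by (simp add: uhp_def)
    next
      show "continuous_on ({0<..} \<times> cbox (-1/2) (1/2)) (\<lambda>(v, u). \<i> * deriv K (Complex u v))"
        unfolding case_prod_unfold
        by (intro continuous_intros continuous_on_compose2[OF cont(2)]) (auto simp: uhp_def)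
    next
      fix v :: real assume "v \<in> {0<..}"
      then show "(\<lambda>u. K (Complex u v)) integrable_on cbox (-1/2) (1/2)"
        by (intro integrable_continuous continuous_on_compose2[OF cont(1)] continuous_intros) (auto simp: uhp_def)
    qed (use v0 in auto)
    moreover have "((\<lambda>u. deriv K (Complex u v0)) has_integral K (Complex (1/2) v0) - K (Complex (-1/2) v0)) {-1/2..1/2}"
    proof (rule fundamental_theorem_of_calculus)
      fix u :: real
      have "((\<lambda>u. Complex u v0) has_vector_derivative of_real 1 + 0) (at u within {-1/2..1/2})"
        unfolding C
        by (intro has_vector_derivative_add has_vector_derivative_of_real
            has_vector_derivative_const) (auto intro!: derivative_eq_intros)
      from has_vector_derivative_comp_holomorphic[OF hol _ this] v0
      show "((\<lambda>u. K (Complex u v0)) has_vector_derivative deriv K (Complex u v0)) (at u within {-1/2..1/2})"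
        by (simp add: uhp_def)
    qed simp
    moreover have "K (Complex (1/2) v0) = K (Complex (-1/2) v0)"
    proof -
      have "Complex (1/2) v0 = Complex (-1/2) v0 + 1" by (simp add: complex_eq_iff)
      then show ?thesis using per[of "Complex (-1/2) v0"] v0 by (simp add: uhp_def)
    qed
    ultimately show ?thesis by (simp add: integral_unique)
  qed
  then obtain c where "\<And>v. v \<in> {0<..} \<Longrightarrow> integral (cbox (-1/2) (1/2)) (\<lambda>u. K (Complex u v)) = c"
    using has_vector_derivative_zero_constant[of "{0<..}" "\<lambda>v. integral (cbox (-1/2) (1/2)) (\<lambda>u. K (Complex u v))"]
    by auto
  with assms(3,4) show ?thesis by (simp add: cbox_interval)
qed

section \<open>Shifts of theta by a quarter\<close>

lemma square_mod_4: "(x::int)\<^sup>2 mod 4 = (if even x then 0 else 1)"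
proof (cases "even x")
  case True
  then obtain y where "x = 2 * y" by (elim evenE)
  then show ?thesis by (simp add: power2_eq_square)
next
  case False
  then obtain y where "x = 2 * y + 1" by (elim oddE)
  then have x: "x\<^sup>2 = 4 * (y\<^sup>2 + y) + 1" by (simp add: power2_eq_square algebra_simps)
  have "(4 * z + 1) mod 4 = 1" for z :: int by presburger
  then have "x\<^sup>2 mod 4 = 1" unfolding x .
  then show ?thesis using False by simp
qed

lemma e_int_half: "e (of_int n / 2) = (if even n then 1 else -1)"
proof (cases "even n")
  case True
  then show ?thesis by (elim evenE) simp
next
  case False
  then obtain m where "n = 2 * m + 1" by (elim oddE)
  then show ?thesis by (simp add: add_divide_distrib e_add)
qed

lemma e_int_shift: "e (of_int k * (w + 1/4)) = e (of_int k / 4) * e (of_int k * w)"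
    "e (of_int k * (w + 1/2)) = e (of_int k / 2) * e (of_int k * w)"
  by (simp_all add: distrib_left e_add mult.commute)

text \<open>As squares are 0 or 1 modulo 4, the quarter shift multiplies a term by 1 or
  \<open>\<i>\<close> and the half shift by 1 or -1. The two coefficients are the numbers with sum 1
  and difference \<open>\<i>\<close>.\<close>

lemma theta_quarter_shift:
  assumes "w \<in> uhp"
  shows "theta (w + 1/4) = (1 + \<i>) / 2 * theta w + (1 - \<i>) / 2 * theta (w + 1/2)"
proof -
  have "((\<lambda>n::int. (1 + \<i>) / 2 * e (of_int (n\<^sup>2) * w) + (1 - \<i>) / 2 * e (of_int (n\<^sup>2) * (w + 1/2))) has_sum
      (1 + \<i>) / 2 * theta w + (1 - \<i>) / 2 * theta (w + 1/2)) UNIV"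
    using assms by (intro has_sum_add has_sum_cmult_right theta_has_sum) (auto simp: uhp_def)
  moreover have "(1 + \<i>) / 2 * e (of_int (n\<^sup>2) * w) + (1 - \<i>) / 2 * e (of_int (n\<^sup>2) * (w + 1/2))
      = e (of_int (n\<^sup>2) * (w + 1/4))" for n :: int
    unfolding e_int_shift e_int_half e_int_quarter square_mod_4
    by (simp add: field_simps)
  ultimately have "((\<lambda>n::int. e (of_int (n\<^sup>2) * (w + 1/4))) has_sum
      (1 + \<i>) / 2 * theta w + (1 - \<i>) / 2 * theta (w + 1/2)) UNIV" by simp
  moreover have "((\<lambda>n::int. e (of_int (n\<^sup>2) * (w + 1/4))) has_sum theta (w + 1/4)) UNIV"
    using assms by (intro theta_has_sum) (simp add: uhp_def)
  ultimately show ?thesis by (metis has_sum_unique)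
qed

text \<open>Packages the regularity demanded by \<open>green_truncated_fundamental_domain\<close>,
  with the partial derivatives as explicit functions so that they can be carried through sums,
  products and affine substitutions.\<close>

definition partials_on_uhp :: "(complex \<Rightarrow> complex) \<Rightarrow> (complex \<Rightarrow> complex) \<Rightarrow> (complex \<Rightarrow> complex) \<Rightarrow> bool" where
  "partials_on_uhp H Hu Hv \<longleftrightarrow>
     (\<forall>\<tau>\<in>uhp. (H has_derivative (\<lambda>h. of_real (Re h) * Hu \<tau> + of_real (Im h) * Hv \<tau>)) (at \<tau>)) \<and>
     continuous_on uhp Hu \<and> continuous_on uhp Hv"

lemma partials_smooth:
  assumes "smooth_uhp g"
  shows "partials_on_uhp g (d_u g) (d_v g)"
proof -
  have "g differentiable_on uhp" "d_u g differentiable_on uhp" "d_v g differentiable_on uhp"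
    using assms[unfolded smooth_uhp_def, rule_format, of 0 0]
      assms[unfolded smooth_uhp_def, rule_format, of 1 0]
      assms[unfolded smooth_uhp_def, rule_format, of 0 1] by simp_all
  then show ?thesis
    unfolding partials_on_uhp_def
    by (intro conjI ballI has_derivative_d_u_d_v differentiable_imp_continuous_on)
qed

lemma partials_continuous:
  assumes "partials_on_uhp H Hu Hv" shows "continuous_on uhp H"
proof (rule continuous_at_imp_continuous_on, intro ballI)
  fix \<tau> assume "\<tau> \<in> uhp"
  then show "isCont H \<tau>"
    using assms has_derivative_continuous unfolding partials_on_uhp_def by blast
qed

lemma partials_holomorphic:
  assumes "F holomorphic_on uhp"
  shows "partials_on_uhp F (deriv F) (\<lambda>\<tau>. \<i> * deriv F \<tau>)"
proof -
  have "continuous_on uhp (deriv F)"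
    using holomorphic_deriv[OF assms open_uhp] by (rule holomorphic_on_imp_continuous_on)
  moreover have "(F has_derivative (\<lambda>h. of_real (Re h) * deriv F \<tau> + of_real (Im h) * (\<i> * deriv F \<tau>))) (at \<tau>)"
    if "\<tau> \<in> uhp" for \<tau>
  proof -
    have "of_real (Re h) * deriv F \<tau> + of_real (Im h) * (\<i> * deriv F \<tau>) = deriv F \<tau> * h" for h
      by (subst (3) complex_eq) (simp add: algebra_simps)
    then show ?thesis
      using holomorphic_derivI[OF assms open_uhp that] by (simp add: has_field_derivative_def)
  qed
  ultimately show ?thesis by (auto simp: partials_on_uhp_def intro!: continuous_intros)
qed

lemma partials_mult:
  assumes F: "partials_on_uhp F Fu Fv" and G: "partials_on_uhp G Gu Gv"
  shows "partials_on_uhp (\<lambda>\<tau>. F \<tau> * G \<tau>) (\<lambda>\<tau>. F \<tau> * Gu \<tau> + Fu \<tau> * G \<tau>) (\<lambda>\<tau>. F \<tau> * Gv \<tau> + Fv \<tau> * G \<tau>)"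
  unfolding partials_on_uhp_def
proof (intro conjI ballI)
  fix \<tau> assume "\<tau> \<in> uhp"
  then have "((\<lambda>\<tau>. F \<tau> * G \<tau>) has_derivative (\<lambda>h. F \<tau> * (of_real (Re h) * Gu \<tau> + of_real (Im h) * Gv \<tau>)
      + (of_real (Re h) * Fu \<tau> + of_real (Im h) * Fv \<tau>) * G \<tau>)) (at \<tau>)"
    using F G unfolding partials_on_uhp_def by (intro has_derivative_mult) auto
  then show "((\<lambda>\<tau>. F \<tau> * G \<tau>) has_derivative (\<lambda>h. of_real (Re h) * (F \<tau> * Gu \<tau> + Fu \<tau> * G \<tau>)
      + of_real (Im h) * (F \<tau> * Gv \<tau> + Fv \<tau> * G \<tau>))) (at \<tau>)"
    by (simp add: algebra_simps)
qed (use F G partials_continuous[OF F] partials_continuous[OF G] in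
    \<open>auto simp: partials_on_uhp_def intro!: continuous_intros\<close>)

lemma partials_add:
  assumes F: "partials_on_uhp F Fu Fv" and G: "partials_on_uhp G Gu Gv"
  shows "partials_on_uhp (\<lambda>\<tau>. F \<tau> + G \<tau>) (\<lambda>\<tau>. Fu \<tau> + Gu \<tau>) (\<lambda>\<tau>. Fv \<tau> + Gv \<tau>)"
  unfolding partials_on_uhp_def
proof (intro conjI ballI)
  fix \<tau> assume "\<tau> \<in> uhp"
  then have "((\<lambda>\<tau>. F \<tau> + G \<tau>) has_derivative (\<lambda>h. (of_real (Re h) * Fu \<tau> + of_real (Im h) * Fv \<tau>)
      + (of_real (Re h) * Gu \<tau> + of_real (Im h) * Gv \<tau>))) (at \<tau>)"
    using F G unfolding partials_on_uhp_def by (intro has_derivative_add) auto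
  then show "((\<lambda>\<tau>. F \<tau> + G \<tau>) has_derivative (\<lambda>h. of_real (Re h) * (Fu \<tau> + Gu \<tau>)
      + of_real (Im h) * (Fv \<tau> + Gv \<tau>))) (at \<tau>)"
    by (simp add: algebra_simps)
qed (use F G in \<open>auto simp: partials_on_uhp_def intro!: continuous_intros\<close>)

lemma partials_cmult:
  assumes "partials_on_uhp F Fu Fv"
  shows "partials_on_uhp (\<lambda>\<tau>. c * F \<tau>) (\<lambda>\<tau>. c * Fu \<tau>) (\<lambda>\<tau>. c * Fv \<tau>)"
  using partials_mult[OF partials_holomorphic[of "\<lambda>_. c"] assms] by simp

lemma partials_affine:
  fixes r t :: real
  assumes "partials_on_uhp F Fu Fv" "r > 0"
  shows "partials_on_uhp (\<lambda>\<tau>. F (of_real r * \<tau> + of_real t)) (\<lambda>\<tau>. of_real r * Fu (of_real r * \<tau> + of_real t))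
     (\<lambda>\<tau>. of_real r * Fv (of_real r * \<tau> + of_real t))"
  unfolding partials_on_uhp_def
proof (intro conjI ballI)
  let ?m = "\<lambda>\<tau>. of_real r * \<tau> + of_real t :: complex"
  have m: "?m \<tau> \<in> uhp" if "\<tau> \<in> uhp" for \<tau>
    using that assms(2) by (simp add: uhp_def)
  fix \<tau> assume \<tau>: "\<tau> \<in> uhp"
  have "(?m has_derivative (\<lambda>h. of_real r * h)) (at \<tau>)"
    by (auto intro!: derivative_eq_intros)
  from has_derivative_compose[OF this, of F] assms(1) m[OF \<tau>]
  have "((\<lambda>\<tau>. F (?m \<tau>)) has_derivative (\<lambda>h. of_real (Re (of_real r * h)) * Fu (?m \<tau>)
     + of_real (Im (of_real r * h)) * Fv (?m \<tau>))) (at \<tau>)"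
    unfolding partials_on_uhp_def by blast
  then show "((\<lambda>\<tau>. F (?m \<tau>)) has_derivative (\<lambda>h. of_real (Re h) * (of_real r * Fu (?m \<tau>))
     + of_real (Im h) * (of_real r * Fv (?m \<tau>)))) (at \<tau>)"
    by (simp add: mult_ac)
next
  have cont: "continuous_on uhp Fu" "continuous_on uhp Fv"
    using assms(1) by (auto simp: partials_on_uhp_def)
  show "continuous_on uhp (\<lambda>\<tau>. of_real r * Fu (of_real r * \<tau> + of_real t))"
    using assms(2) by (intro continuous_intros continuous_on_compose2[OF cont(1)]) (auto simp: uhp_def)
  show "continuous_on uhp (\<lambda>\<tau>. of_real r * Fv (of_real r * \<tau> + of_real t))"
    using assms(2) by (intro continuous_intros continuous_on_compose2[OF cont(2)]) (auto simp: uhp_def)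
qed

text \<open>The second hypothesis is the Cauchy-Riemann equation; it makes the real derivative
  multiplication by the complex number \<open>Fu \<tau>\<close>.\<close>

lemma holomorphic_partials:
  assumes "partials_on_uhp F Fu Fv" "\<And>\<tau>. \<tau> \<in> uhp \<Longrightarrow> Fu \<tau> + \<i> * Fv \<tau> = 0"
  shows "F holomorphic_on uhp"
  unfolding holomorphic_on_open[OF open_uhp]
proof
  fix \<tau> assume \<tau>: "\<tau> \<in> uhp"
  have Fu: "Fu \<tau> = - \<i> * Fv \<tau>" using assms(2)[OF \<tau>] by (simp add: add_eq_0_iff)
  have "of_real (Re h) * Fu \<tau> + of_real (Im h) * Fv \<tau> = Fu \<tau> * h" for h
    unfolding Fu by (subst (3) complex_eq) (simp add: algebra_simps)
  then have "(\<lambda>h. of_real (Re h) * Fu \<tau> + of_real (Im h) * Fv \<tau>) = (*) (Fu \<tau>)" by (rule ext)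
  then have "(F has_derivative (*) (Fu \<tau>)) (at \<tau>)"
    using assms(1) \<tau> unfolding partials_on_uhp_def by metis
  then show "\<exists>F'. (F has_field_derivative F') (at \<tau>)"
    by (auto simp: has_field_derivative_def)
qed

text \<open>A combination \<open>h\<close> of shifts of \<open>g\<close> is chosen that keeps only
  exponents 1 and 2 modulo 4. By \<open>theta_quarter_shift\<close> its \<tau>-bar derivative
  vanishes, so \<open>h\<close> is holomorphic and its Fourier coefficients do not depend on the
  height. By the plus condition on \<open>ap\<close> they come from the non-holomorphic part alone,
  which decays with the height, so they are 0.\<close>

lemma Maass_nonhol_coeff_eq_0:
  assumes smooth: "smooth_uhp g" and xi: "\<forall>\<tau>\<in>uhp. xi (3/2) g \<tau> = theta \<tau>"
    and exp: "Maass_expansion g ap am" and plus: "kohnen_plus ap"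
    and n: "n mod 4 \<in> {1, 2}" and v: "v > 0"
  shows "Maass_nonhol_coeff am n v = 0"
proof -
  \<comment> \<open>The coefficients are conjugate to those of \<open>theta_quarter_shift\<close>,
    because the \<tau>-bar derivative of \<open>g\<close> involves
    \<open>cnj (theta w)\<close>.\<close>
  define h where "h = (\<lambda>w. g (w + 1/4) + (- (1 - \<i>) / 2 * g w + - (1 + \<i>) / 2 * g (w + 1/2)))"
  \<comment> \<open>The factor by which passing from \<open>g\<close> to \<open>h\<close> multiplies
    the term of exponent \<open>n\<close>.\<close>
  define \<epsilon> where "\<epsilon> = (\<lambda>n. e (of_int n / 4) - (1 - \<i>) / 2 - (1 + \<i>) / 2 * e (of_int n / 2))"
  have shift: "w + of_real r \<in> uhp" if "w \<in> uhp" for w r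
    using that by (simp add: uhp_def)
  have shift': "w + 1/4 \<in> uhp" "w + 1/2 \<in> uhp" if "w \<in> uhp" for w
    using that by (simp_all add: uhp_def)
  have \<epsilon>: "\<epsilon> m = (if m mod 4 = 1 then 2 * \<i> else if m mod 4 = 2 then -2 else 0)" for m
  proof -
    have "even m \<longleftrightarrow> m mod 4 = 0 \<or> m mod 4 = 2" by presburger
    moreover have "m mod 4 \<in> {0,1,2,3}" using pos_mod_bound[of 4 m] pos_mod_sign[of 4 m] by auto
    ultimately show ?thesis by (auto simp: \<epsilon>_def e_int_half e_int_quarter field_simps)
  qed
  have alg: "C * (a * E) + (- p / 2 * (C * E) + - q / 2 * (C * (b * E))) = (a - p / 2 - q / 2 * b) * C * E"
    for C a b E p q :: complex
    by (simp add: algebra_simps)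
  have h_sum: "((\<lambda>m. (\<epsilon> m * Maass_nonhol_coeff am m (Im w)) * e (of_int m * w)) has_sum h w) UNIV"
    if w: "w \<in> uhp" for w
  proof -
    let ?c = "\<lambda>m. ap m + Maass_nonhol_coeff am m (Im w)"
    have s: "((\<lambda>m. ?c m * e (of_int m * (w + of_real r))) has_sum g (w + of_real r)) UNIV" for r
      using Maass_expansion_has_sum(1)[OF exp shift[OF w, of r]] by simp
    have "((\<lambda>m. ?c m * e (of_int m * (w + 1/4)) + (- (1 - \<i>) / 2 * (?c m * e (of_int m * w))
        + - (1 + \<i>) / 2 * (?c m * e (of_int m * (w + 1/2))))) has_sum h w) UNIV"
      unfolding h_def using s[of "1/4"] s[of 0] s[of "1/2"]
      by (intro has_sum_add has_sum_cmult_right) simp_all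
    moreover have "?c m * e (of_int m * (w + 1/4)) + (- (1 - \<i>) / 2 * (?c m * e (of_int m * w))
        + - (1 + \<i>) / 2 * (?c m * e (of_int m * (w + 1/2))))
        = (\<epsilon> m * Maass_nonhol_coeff am m (Im w)) * e (of_int m * w)" for m
    proof -
      have "?c m * e (of_int m * (w + 1/4)) + (- (1 - \<i>) / 2 * (?c m * e (of_int m * w))
        + - (1 + \<i>) / 2 * (?c m * e (of_int m * (w + 1/2)))) = (\<epsilon> m * ?c m) * e (of_int m * w)"
        unfolding e_int_shift \<epsilon>_def by (rule alg)
      also have "\<epsilon> m * ?c m = \<epsilon> m * Maass_nonhol_coeff am m (Im w)"
        using plus by (auto simp: \<epsilon> kohnen_plus_def)
      finally show ?thesis .
    qed
    ultimately show ?thesis by simp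
  qed
  have h_per: "h (w + 1) = h w" if "w \<in> uhp" for w
  proof -
    have "w + 1 \<in> uhp" using that by (simp add: uhp_def)
    from h_sum[OF this] have "((\<lambda>m. (\<epsilon> m * Maass_nonhol_coeff am m (Im w)) * e (of_int m * w)) has_sum h (w + 1)) UNIV"
      by (simp add: distrib_left e_add)
    with h_sum[OF that] show ?thesis by (metis has_sum_unique)
  qed
  have "h holomorphic_on uhp"
  proof (rule holomorphic_partials)
    note p = partials_smooth[OF smooth]
    show "partials_on_uhp h
       (\<lambda>w. d_u g (w + 1/4) + (- (1 - \<i>) / 2 * d_u g w + - (1 + \<i>) / 2 * d_u g (w + 1/2)))
       (\<lambda>w. d_v g (w + 1/4) + (- (1 - \<i>) / 2 * d_v g w + - (1 + \<i>) / 2 * d_v g (w + 1/2)))"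
      unfolding h_def using partials_affine[OF p, of 1 "1/4"] partials_affine[OF p, of 1 "1/2"]
      by (intro partials_add partials_cmult p) simp_all
  next
    fix w assume w: "w \<in> uhp"
    have "d_u g (w + 1/4) + (- (1 - \<i>) / 2 * d_u g w + - (1 + \<i>) / 2 * d_u g (w + 1/2))
       + \<i> * (d_v g (w + 1/4) + (- (1 - \<i>) / 2 * d_v g w + - (1 + \<i>) / 2 * d_v g (w + 1/2)))
      = (d_u g (w + 1/4) + \<i> * d_v g (w + 1/4)) - (1 - \<i>) / 2 * (d_u g w + \<i> * d_v g w)
        - (1 + \<i>) / 2 * (d_u g (w + 1/2) + \<i> * d_v g (w + 1/2))"
      by (simp add: algebra_simps add_divide_distrib diff_divide_distrib)
    also have "\<dots> = \<i> * of_real (Im w powr (-3/2)) * (cnj (theta (w + 1/4)) - (1 - \<i>) / 2 * cnj (theta w)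
        - (1 + \<i>) / 2 * cnj (theta (w + 1/2)))"
      using xi shift'[OF w] w by (simp add: d_taubar_of_xi_theta algebra_simps)
    also have "cnj (theta (w + 1/4)) = (1 - \<i>) / 2 * cnj (theta w) + (1 + \<i>) / 2 * cnj (theta (w + 1/2))"
      unfolding theta_quarter_shift[OF w] by simp
    finally show "d_u g (w + 1/4) + (- (1 - \<i>) / 2 * d_u g w + - (1 + \<i>) / 2 * d_u g (w + 1/2))
       + \<i> * (d_v g (w + 1/4) + (- (1 - \<i>) / 2 * d_v g w + - (1 + \<i>) / 2 * d_v g (w + 1/2))) = 0"
      by simp
  qed
  then have K_hol: "(\<lambda>w. h w * e (- of_int n * w)) holomorphic_on uhp"
    by (intro holomorphic_intros)
  have K_per: "h (w + 1) * e (- of_int n * (w + 1)) = h w * e (- of_int n * w)" if "w \<in> uhp" for w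
    using h_per[OF that] by (simp add: distrib_left)
  have K_int: "integral {-1/2..1/2} (\<lambda>u. h (Complex u t) * e (- of_int n * Complex u t)) = \<epsilon> n * Maass_nonhol_coeff am n t"
    if t: "t > 0" for t
  proof -
    have "((\<lambda>m. (\<epsilon> m * Maass_nonhol_coeff am m t) * e (of_int (m - n) * Complex u t)) has_sum
        h (Complex u t) * e (- of_int n * Complex u t)) UNIV" for u
    proof -
      have "((\<lambda>m. (\<epsilon> m * Maass_nonhol_coeff am m t) * e (of_int m * Complex u t)) has_sum h (Complex u t)) UNIV"
        using h_sum[of "Complex u t"] t by (simp add: uhp_def)
      from has_sum_cmult_left[OF this, of "e (- of_int n * Complex u t)"]
      show ?thesis by (simp add: mult.assoc e_add[symmetric] left_diff_distrib)
    qed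
    from constant_term_has_integral[OF this] show ?thesis by (simp add: integral_unique)
  qed
  \<comment> \<open>Heights \<open>v\<close> and \<open>4 * v\<close> are compared: the coefficient
    is the same at both, yet the decay estimate gives the factor
    \<open>4 powr (-1/2) = 1/2\<close>.\<close>
  have "\<epsilon> n * Maass_nonhol_coeff am n (v * 4) = \<epsilon> n * Maass_nonhol_coeff am n v"
  proof -
    have v4: "v * 4 > 0" using v by simp
    have "integral {-1/2..1/2} (\<lambda>u. h (Complex u (v * 4)) * e (- of_int n * Complex u (v * 4)))
        = integral {-1/2..1/2} (\<lambda>u. h (Complex u v) * e (- of_int n * Complex u v))"
      by (rule integral_periodic_holomorphic[where K = "\<lambda>w. h w * e (- of_int n * w)"])
         (use K_hol K_per v v4 in auto)
    then show ?thesis unfolding K_int[OF v] K_int[OF v4] .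
  qed
  moreover have "\<epsilon> n \<noteq> 0" using n by (auto simp: \<epsilon>)
  ultimately have eq: "Maass_nonhol_coeff am n (v * 4) = Maass_nonhol_coeff am n v" by simp
  have p: "(4::real) powr (-1/2) = 1/2"
    using powr_half_sqrt[of 4] by (simp add: powr_minus)
  have "norm (Maass_nonhol_coeff am n v) \<le> 1/2 * norm (Maass_nonhol_coeff am n v)"
    using norm_Maass_nonhol_coeff_le[OF v, of 4 am n] unfolding p eq by fastforce
  then have "norm (Maass_nonhol_coeff am n v) \<le> 0" by linarith
  then show ?thesis by (simp only: norm_le_zero_iff)
qed


section \<open>Passing from level 4 to level 1\<close>

definition quarter_avg :: "(complex \<Rightarrow> complex) \<Rightarrow> complex \<Rightarrow> complex" where
  "quarter_avg p \<tau> = (p ((\<tau> + 1) / 4) + p ((\<tau> - 1) / 4)) / 2"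

lemma quarter_shift_in_uhp: "\<tau> \<in> uhp \<Longrightarrow> (\<tau> + 1) / 4 \<in> uhp" "\<tau> \<in> uhp \<Longrightarrow> (\<tau> - 1) / 4 \<in> uhp"
  by (simp_all add: uhp_def)

lemma e_quarter_shift:
  "e (of_int k * ((\<tau> + 1) / 4)) = e (of_int k / 4) * e (of_int k * (\<tau> / 4))"
  "e (of_int k * ((\<tau> - 1) / 4)) = e (- of_int k / 4) * e (of_int k * (\<tau> / 4))"
  by (simp_all add: e_add[symmetric] add_divide_distrib diff_divide_distrib algebra_simps)

text \<open>A term of exponent \<open>k\<close> is multiplied by the mean of \<open>e (k/4)\<close>
  and \<open>e (-k/4)\<close>, which is 1, 0, -1, 0 for \<open>k\<close> congruent to 0, 1, 2, 3
  modulo 4; hypothesis \<open>c\<close> removes the third case. Coefficients depending on the height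
  are admissible because both shifted points have height \<open>Im \<tau> / 4\<close>.\<close>

lemma quarter_avg_has_sum:
  assumes \<tau>: "\<tau> \<in> uhp"
    and p: "\<And>w. w \<in> uhp \<Longrightarrow> ((\<lambda>i. c i (Im w) * e (of_int (k i) * w)) has_sum p w) I"
    and c: "\<And>i. i \<in> I \<Longrightarrow> k i mod 4 = 2 \<Longrightarrow> c i (Im \<tau> / 4) = 0"
  shows "((\<lambda>i. c i (Im \<tau> / 4) * e (of_int (k i div 4) * \<tau>)) has_sum quarter_avg p \<tau>) {i\<in>I. 4 dvd k i}"
proof -
  have "((\<lambda>i. 1 / 2 * (c i (Im \<tau> / 4) * e (of_int (k i) * ((\<tau> + 1) / 4)) + c i (Im \<tau> / 4) * e (of_int (k i) * ((\<tau> - 1) / 4))))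
      has_sum 1 / 2 * (p ((\<tau> + 1) / 4) + p ((\<tau> - 1) / 4))) I"
    using p[OF quarter_shift_in_uhp(1)[OF \<tau>]] p[OF quarter_shift_in_uhp(2)[OF \<tau>]]
    by (intro has_sum_cmult_right has_sum_add) simp_all
  then have s: "((\<lambda>i. 1 / 2 * (c i (Im \<tau> / 4) * e (of_int (k i) * ((\<tau> + 1) / 4)) + c i (Im \<tau> / 4) * e (of_int (k i) * ((\<tau> - 1) / 4))))
      has_sum quarter_avg p \<tau>) I"
    by (simp add: quarter_avg_def)
  have eq: "1 / 2 * (c i (Im \<tau> / 4) * e (of_int (k i) * ((\<tau> + 1) / 4)) + c i (Im \<tau> / 4) * e (of_int (k i) * ((\<tau> - 1) / 4)))
      = (if 4 dvd k i then c i (Im \<tau> / 4) * e (of_int (k i div 4) * \<tau>) else 0)" if i: "i \<in> I" for i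
  proof -
    let ?r = "e (of_int (k i) / 4)"
    have r': "e (- of_int (k i) / 4) = inverse ?r" using e_minus[of "of_int (k i) / 4"] by simp
    have "k i mod 4 \<in> {0,1,2,3}" using pos_mod_bound[of 4 "k i"] pos_mod_sign[of 4 "k i"] by auto
    then consider "4 dvd k i" | "k i mod 4 = 1" | "k i mod 4 = 2" | "k i mod 4 = 3"
      by (auto simp: dvd_eq_mod_eq_0)
    then show ?thesis
    proof cases
      case 1
      then obtain m where "k i = 4 * m" by (elim dvdE)
      then have "of_int (k i) * ((\<tau> + 1) / 4) = of_int m * \<tau> + of_int m"
          "of_int (k i) * ((\<tau> - 1) / 4) = of_int m * \<tau> - of_int m"
        by (simp_all add: field_simps)
      then show ?thesis using \<open>k i = 4 * m\<close> by (simp only: e_diff_of_int) (simp add: e_add)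
    qed (unfold e_quarter_shift r' e_int_quarter, use c[OF i] in \<open>auto simp: dvd_eq_mod_eq_0\<close>)
  qed
  have "((\<lambda>i. if 4 dvd k i then c i (Im \<tau> / 4) * e (of_int (k i div 4) * \<tau>) else 0) has_sum quarter_avg p \<tau>) I"
    using s by (subst (asm) has_sum_cong[OF eq])
  then show ?thesis
    by (rule has_sum_cong_neutral[THEN iffD1, rotated -1]) auto
qed

lemma quarter_avg_periodic:
  assumes \<tau>: "\<tau> \<in> uhp"
    and p: "\<And>w. w \<in> uhp \<Longrightarrow> ((\<lambda>i. c i (Im w) * e (of_int (k i) * w)) has_sum p w) I"
    and c: "\<And>i v. i \<in> I \<Longrightarrow> k i mod 4 = 2 \<Longrightarrow> v > 0 \<Longrightarrow> c i v = 0"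
  shows "quarter_avg p (\<tau> + 1) = quarter_avg p \<tau>"
proof -
  have v: "Im \<tau> / 4 > 0" "\<tau> + 1 \<in> uhp" using \<tau> by (auto simp: uhp_def)
  have "((\<lambda>i. c i (Im (\<tau> + 1) / 4) * e (of_int (k i div 4) * (\<tau> + 1))) has_sum quarter_avg p (\<tau> + 1)) {i\<in>I. 4 dvd k i}"
    by (rule quarter_avg_has_sum[where I = I]) (use v p c in auto)
  then have "((\<lambda>i. c i (Im \<tau> / 4) * e (of_int (k i div 4) * \<tau>)) has_sum quarter_avg p (\<tau> + 1)) {i\<in>I. 4 dvd k i}"
    by (simp add: distrib_left e_add)
  moreover have "((\<lambda>i. c i (Im \<tau> / 4) * e (of_int (k i div 4) * \<tau>)) has_sum quarter_avg p \<tau>) {i\<in>I. 4 dvd k i}"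
    by (rule quarter_avg_has_sum[where I = I]) (use v p c \<tau> in auto)
  ultimately show ?thesis by (rule has_sum_unique)
qed

text \<open>The points \<open>(-1/\<tau> \<plusminus> 1)/4\<close> are the images of \<open>(\<tau> \<mp> 1)/4\<close> under elements of \<open>\<Gamma>\<^sub>0(4)\<close>
  with lower left entry \<open>\<plusminus>4\<close>.\<close>

lemma quarter_avg_inversion:
  assumes \<tau>: "\<tau> \<in> uhp" and "even k"
    and p: "\<And>c w. 4 dvd c \<Longrightarrow> w \<in> uhp \<Longrightarrow> p (moebius 1 0 c 1 w) = (of_int c * w + 1) ^ k * p w"
  shows "quarter_avg p (- 1 / \<tau>) = \<tau> ^ k * quarter_avg p \<tau>"
proof -
  have nz: "\<tau> \<noteq> 0" using \<tau> by (auto simp: uhp_def)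
  have m: "(- 1 / \<tau> + 1) / 4 = moebius 1 0 4 1 ((\<tau> - 1) / 4)" "(- 1 / \<tau> - 1) / 4 = moebius 1 0 (-4) 1 ((\<tau> + 1) / 4)"
    using nz by (simp_all add: moebius_1_0 field_simps)
  have "p ((- 1 / \<tau> + 1) / 4) = \<tau> ^ k * p ((\<tau> - 1) / 4)"
    unfolding m using p[of 4, OF _ quarter_shift_in_uhp(2)[OF \<tau>]] by (simp add: diff_divide_distrib right_diff_distrib)
  moreover have "p ((- 1 / \<tau> - 1) / 4) = \<tau> ^ k * p ((\<tau> + 1) / 4)"
  proof -
    \<comment> \<open>The sign of \<open>- \<tau>\<close> disappears in the even power
      \<open>k\<close>.\<close>
    have j: "of_int (-4) * ((\<tau> + 1) / 4) + 1 = - \<tau>" by (simp add: field_simps)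
    show ?thesis
      unfolding m using p[of "-4", OF _ quarter_shift_in_uhp(1)[OF \<tau>], unfolded j] \<open>even k\<close> by simp
  qed
  ultimately show ?thesis by (simp add: quarter_avg_def algebra_simps)
qed

lemma partials_quarter_avg:
  assumes "partials_on_uhp p pu pv"
  shows "partials_on_uhp (quarter_avg p) (\<lambda>\<tau>. quarter_avg pu \<tau> / 4) (\<lambda>\<tau>. quarter_avg pv \<tau> / 4)"
proof -
  have eq: "of_real (1/4) * \<tau> + of_real (1/4) = (\<tau> + 1) / 4" "of_real (1/4) * \<tau> + of_real (-1/4) = (\<tau> - 1) / 4" for \<tau> :: complex
    by (simp_all add: field_simps)
  have "partials_on_uhp (\<lambda>\<tau>. 1/2 * (p ((\<tau> + 1) / 4) + p ((\<tau> - 1) / 4)))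
     (\<lambda>\<tau>. 1/2 * (of_real (1/4) * pu ((\<tau> + 1) / 4) + of_real (1/4) * pu ((\<tau> - 1) / 4)))
     (\<lambda>\<tau>. 1/2 * (of_real (1/4) * pv ((\<tau> + 1) / 4) + of_real (1/4) * pv ((\<tau> - 1) / 4)))"
    using partials_affine[OF assms, of "1/4" "1/4", unfolded eq] partials_affine[OF assms, of "1/4" "-1/4", unfolded eq]
    by (intro partials_cmult partials_add) simp_all
  then show ?thesis unfolding quarter_avg_def by (simp add: field_simps)
qed

text \<open>The product stays indexed by pairs, without collecting equal exponents; with
  \<open>w\<close> fixed, \<open>c\<close> may be the coefficients at the height of
  \<open>w\<close>.\<close>

lemma times_theta_has_sum:
  assumes "w \<in> uhp" "((\<lambda>n. c n * e (of_int n * w)) has_sum s) UNIV"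
  shows "((\<lambda>i. c (fst i) * e (of_int (fst i + (snd i)\<^sup>2) * w)) has_sum s * theta w) UNIV"
proof -
  from has_sum_mult_Times[OF assms(2) theta_has_sum[OF assms(1)]]
  show ?thesis
    by (simp add: case_prod_unfold distrib_right e_add mult.assoc)
qed

text \<open>Lets the plus condition on one factor supply the hypothesis on exponents 2 modulo 4 in
  \<open>quarter_avg_has_sum\<close> after multiplication by \<open>theta\<close>.\<close>

lemma plus_space_exponent:
  fixes n x :: int
  assumes "(n + x\<^sup>2) mod 4 = 2"
  shows "n mod 4 \<in> {1, 2}"
  using assms square_mod_4[of x] by (auto split: if_splits) presburger+

text \<open>The product of the two theta multiples at a single point \<open>w\<close> is absolutely
  summable, and on pairs of total exponent 0 the exponentials cancel, leaving the bare
  coefficients.\<close>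

lemma pairing_summable:
  assumes \<tau>: "w \<in> uhp" and a: "(\<lambda>n. a n * e (of_int n * w)) summable_on UNIV"
    and b: "(\<lambda>n. b n * e (of_int n * w)) summable_on UNIV"
    and J: "\<And>i j. (i, j) \<in> J \<Longrightarrow> fst i + (snd i)\<^sup>2 + (fst j + (snd j)\<^sup>2) = 0"
  shows "(\<lambda>(i, j). a (fst i) * b (fst j)) summable_on J"
proof -
  have "((\<lambda>(i, j). (a (fst i) * e (of_int (fst i + (snd i)\<^sup>2) * w)) * (b (fst j) * e (of_int (fst j + (snd j)\<^sup>2) * w)))
     summable_on UNIV \<times> UNIV)"
    using has_sum_mult_Times[OF times_theta_has_sum[OF \<tau> has_sum_infsum[OF a]] times_theta_has_sum[OF \<tau> has_sum_infsum[OF b]]]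
    by (rule has_sum_imp_summable)
  then have "((\<lambda>(i, j). (a (fst i) * e (of_int (fst i + (snd i)\<^sup>2) * w)) * (b (fst j) * e (of_int (fst j + (snd j)\<^sup>2) * w)))
     summable_on J)"
    by (rule summable_on_subset) auto
  also have "?this \<longleftrightarrow> ?thesis"
  proof (rule summable_on_cong, clarify)
    fix n x m y assume "((n, x), (m, y)) \<in> J"
    from J[OF this] have z: "n + x\<^sup>2 + (m + y\<^sup>2) = 0" by simp
    have "e (of_int (n + x\<^sup>2) * w) * e (of_int (m + y\<^sup>2) * w) = e (of_int (n + x\<^sup>2 + (m + y\<^sup>2)) * w)"
      by (simp add: e_add[symmetric] distrib_right)
    also have "\<dots> = 1" unfolding z by simp
    finally have *: "e (of_int (n + x\<^sup>2) * w) * e (of_int (m + y\<^sup>2) * w) = 1" .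
    have "(a n * e (of_int (n + x\<^sup>2) * w)) * (b m * e (of_int (m + y\<^sup>2) * w))
        = a n * b m * (e (of_int (n + x\<^sup>2) * w) * e (of_int (m + y\<^sup>2) * w))" by (simp only: mult_ac)
    then show "a (fst (n, x)) * e (of_int (fst (n, x) + (snd (n, x))\<^sup>2) * w) *
        (b (fst (m, y)) * e (of_int (fst (m, y) + (snd (m, y))\<^sup>2) * w)) = a (fst (n, x)) * b (fst (m, y))"
      by (simp only: * fst_conv snd_conv mult_1_right)
  qed
  finally show ?thesis .
qed

text \<open>With \<open>i\<close> and \<open>j\<close> indexing the expansions of the products of
  \<open>f\<close> and \<open>g\<close> with \<open>theta\<close>, these are the pairs contributing
  exponent 0 to the product of the two averages.\<close>

definition constant_term_index :: "((int \<times> int) \<times> (int \<times> int)) set" where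
  "constant_term_index = {(i, j). 4 dvd fst i + (snd i)\<^sup>2 \<and> 4 dvd fst j + (snd j)\<^sup>2
     \<and> (fst i + (snd i)\<^sup>2) div 4 + (fst j + (snd j)\<^sup>2) div 4 = 0}"

lemma constant_term_index_sum:
  "(i, j) \<in> constant_term_index \<Longrightarrow> fst i + (snd i)\<^sup>2 + (fst j + (snd j)\<^sup>2) = 0"
  by (auto simp: constant_term_index_def elim!: dvdE)

text \<open>The substitution is \<open>n = - d\<close>,
  \<open>m = d - x\<^sup>2 - y\<^sup>2\<close>. It yields the condition
  \<open>4 dvd x\<^sup>2 - d\<close> in place of equal parity of \<open>x\<close> and
  \<open>d\<close>; the two differ only for \<open>d\<close> congruent to 2 or 3 modulo 4, where
  \<open>a (- d) = 0\<close> by the plus condition.\<close>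

lemma infsum_constant_term_index:
  fixes a b :: "int \<Rightarrow> complex"
  assumes sum: "(\<lambda>(i, j). a (fst i) * b (fst j)) summable_on constant_term_index"
    and a: "kohnen_plus a"
  shows "(\<Sum>\<^sub>\<infinity>(i, j)\<in>constant_term_index. a (fst i) * b (fst j)) =
     (\<Sum>\<^sub>\<infinity>d. a (- d) * (\<Sum>\<^sub>\<infinity>(x, y)\<in>{(x, y). x mod 2 = d mod 2}. b (d - x\<^sup>2 - y\<^sup>2)))"
proof -
  define K where "K = {(d::int, (x::int, y::int)). 4 dvd x\<^sup>2 - d}"
  define S where "S = (SIGMA d : (UNIV :: int set). {(x::int, y::int). x mod 2 = d mod 2})"
  define t where "t = (\<lambda>(d, (x, y)). a (- d) * b (d - x\<^sup>2 - y\<^sup>2))"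
  define f where "f = (\<lambda>(d::int, (x::int, y::int)). ((- d, x), (d - x\<^sup>2 - y\<^sup>2, y)))"
  define g where "g = (\<lambda>((n::int, x::int), (m::int, y::int)). (- n, (x, y)))"
  have 1: "f (g p) = p" "g p \<in> K" if "p \<in> constant_term_index" for p
  proof -
    obtain n x m y where p: "p = ((n, x), (m, y))" by (metis surj_pair)
    from constant_term_index_sum[of "(n, x)" "(m, y)"] that p have "n + x\<^sup>2 + (m + y\<^sup>2) = 0" by simp
    then show "f (g p) = p" by (simp add: p f_def g_def)
    show "g p \<in> K" using that by (simp add: p g_def K_def constant_term_index_def add.commute)
  qed
  have 2: "g (f q) = q" "f q \<in> constant_term_index" if "q \<in> K" for q
  proof -
    obtain d x y where q: "q = (d, (x, y))" by (metis surj_pair)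
    show "g (f q) = q" by (simp add: q f_def g_def)
    have "4 dvd x\<^sup>2 - d" using that by (simp add: q K_def)
    then obtain m where m: "x\<^sup>2 - d = 4 * m" by (elim dvdE)
    then have "- d + x\<^sup>2 = 4 * m" "d - x\<^sup>2 - y\<^sup>2 + y\<^sup>2 = 4 * (- m)" by auto
    then show "f q \<in> constant_term_index"
      unfolding constant_term_index_def q f_def mem_Collect_eq case_prod_conv fst_conv snd_conv
      by (simp only:) simp
  qed
  have 3: "(\<lambda>(i, j). a (fst i) * b (fst j)) (f q) = t q" for q
    by (simp add: f_def t_def case_prod_unfold)
  have neutral: "t q = 0" if "q \<in> (K - S) \<union> (S - K)" for q
  proof -
    obtain d x y where q: "q = (d, (x, y))" by (metis surj_pair)
    have "4 dvd x\<^sup>2 - d \<longleftrightarrow> x\<^sup>2 mod 4 = d mod 4" by (simp add: mod_eq_dvd_iff)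
    moreover have "\<not> (4 dvd x\<^sup>2 - d \<longleftrightarrow> x mod 2 = d mod 2)" using that by (auto simp: q K_def S_def)
    ultimately have "d mod 4 \<in> {2, 3}"
      unfolding square_mod_4 by (auto split: if_splits) presburger+
    then have "(- d) mod 4 \<in> {1, 2}" by auto presburger+
    then show ?thesis using a by (auto simp: q t_def kohnen_plus_def)
  qed
  have 4: "t (g p) = (\<lambda>(i, j). a (fst i) * b (fst j)) p" if "p \<in> constant_term_index" for p
    using 3[of "g p"] 1(1)[OF that] by simp
  have "(\<lambda>(i, j). a (fst i) * b (fst j)) summable_on constant_term_index \<longleftrightarrow> t summable_on K"
    by (rule summable_on_reindex_bij_witness[of _ f g]) (fact 1 2 4)+
  with sum have "t summable_on K" by simp
  then have tS: "t summable_on S"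
    by (subst summable_on_cong_neutral[where T = K and g = t]) (use neutral in auto)
  have "(\<Sum>\<^sub>\<infinity>(i, j)\<in>constant_term_index. a (fst i) * b (fst j)) = infsum t K"
    by (rule infsum_reindex_bij_witness[of _ f g]) (fact 1 2 4)+
  also have "\<dots> = infsum t S"
    by (rule infsum_cong_neutral) (use neutral in auto)
  also have "\<dots> = (\<Sum>\<^sub>\<infinity>d. \<Sum>\<^sub>\<infinity>p\<in>{(x, y). x mod 2 = d mod 2}. t (d, p))"
    using infsum_Sigma_banach[OF tS[unfolded S_def]] by (simp add: S_def)
  also have "\<dots> = (\<Sum>\<^sub>\<infinity>d. a (- d) * (\<Sum>\<^sub>\<infinity>(x, y)\<in>{(x, y). x mod 2 = d mod 2}. b (d - x\<^sup>2 - y\<^sup>2)))"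
    by (simp add: t_def case_prod_unfold infsum_cmult_right')
  finally show ?thesis .
qed

text \<open>Integration over a period extracts the terms of exponent 0. Their coefficients are those
  of the holomorphic part plus an error from the non-holomorphic part at height
  \<open>T / 4\<close>, which tends to 0 by termwise decay.\<close>

lemma constant_term_limit:
  assumes f: "q_expansion f a" "kohnen_plus a"
    and g: "smooth_uhp g" "\<forall>\<tau>\<in>uhp. xi (3/2) g \<tau> = theta \<tau>" "Maass_expansion g ap am" "kohnen_plus ap"
  shows "((\<lambda>T. integral {-1/2..1/2} (\<lambda>u. quarter_avg (\<lambda>w. f w * theta w) (Complex u T)
                 * quarter_avg (\<lambda>w. g w * theta w) (Complex u T)))
     \<longlongrightarrow> (\<Sum>\<^sub>\<infinity>d. a (- d) * (\<Sum>\<^sub>\<infinity>(x, y)\<in>{(x, y). x mod 2 = d mod 2}. ap (d - x\<^sup>2 - y\<^sup>2)))) at_top"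
proof -
  let ?J = constant_term_index
  let ?\<delta> = "Maass_nonhol_coeff am"
  let ?k = "\<lambda>i::int \<times> int. fst i + (snd i)\<^sup>2"
  let ?L = "\<lambda>T. integral {-1/2..1/2} (\<lambda>u. quarter_avg (\<lambda>w. f w * theta w) (Complex u T)
                 * quarter_avg (\<lambda>w. g w * theta w) (Complex u T))"
  have f_sum: "((\<lambda>n. a n * e (of_int n * w)) has_sum f w) UNIV" if "w \<in> uhp" for w
    using f(1) that by (simp add: q_expansion_def)
  note g_sum = Maass_expansion_has_sum[OF g(3)]
  have w: "Complex 0 (T / 4) \<in> uhp" if "T > 0" for T using that by (simp add: uhp_def)
  have sum_ap: "(\<lambda>(i, j). a (fst i) * ap (fst j)) summable_on ?J"
    by (rule pairing_summable[OF w[of 1] has_sum_imp_summable[OF f_sum] g_sum(2)])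
       (use w[of 1] constant_term_index_sum in auto)
  have sum_\<delta>: "(\<lambda>(i, j). a (fst i) * ?\<delta> (fst j) (T / 4)) summable_on ?J" if "T > 0" for T
    using g_sum(3)[OF w[OF that]]
    by (intro pairing_summable[OF w[OF that] has_sum_imp_summable[OF f_sum[OF w[OF that]]]])
       (auto simp: constant_term_index_sum)
  define R where "R = (\<lambda>T. \<Sum>\<^sub>\<infinity>(i, j)\<in>?J. a (fst i) * ?\<delta> (fst j) (T / 4))"
  have L: "?L T = (\<Sum>\<^sub>\<infinity>(i, j)\<in>?J. a (fst i) * ap (fst j)) + R T" if T: "T > 0" for T
  proof -
    define c where "c = (\<lambda>(i :: int \<times> int, j :: int \<times> int). a (fst i) * (ap (fst j) + ?\<delta> (fst j) (T / 4)))"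
    define k where "k = (\<lambda>(i :: int \<times> int, j :: int \<times> int). ?k i div 4 + ?k j div 4)"
    let ?I = "{i. 4 dvd ?k i}"
    have "((\<lambda>p. c p * e (of_int (k p) * Complex u T)) has_sum
        quarter_avg (\<lambda>w. f w * theta w) (Complex u T) * quarter_avg (\<lambda>w. g w * theta w) (Complex u T)) (?I \<times> ?I)" for u
    proof -
      have \<tau>: "Complex u T \<in> uhp" using T by (simp add: uhp_def)
      have "((\<lambda>i. a (fst i) * e (of_int (?k i div 4) * Complex u T)) has_sum
          quarter_avg (\<lambda>w. f w * theta w) (Complex u T)) {i\<in>UNIV. 4 dvd ?k i}"
      proof (rule quarter_avg_has_sum[OF \<tau>, where c = "\<lambda>i _. a (fst i)"])
        show "((\<lambda>i. a (fst i) * e (of_int (?k i) * w)) has_sum f w * theta w) UNIV" if "w \<in> uhp" for w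
          using that by (intro times_theta_has_sum f_sum)
        show "a (fst i) = 0" if "?k i mod 4 = 2" for i
          using plus_space_exponent[OF that] f(2) by (auto simp: kohnen_plus_def)
      qed
      moreover have "((\<lambda>i. (ap (fst i) + ?\<delta> (fst i) (Im (Complex u T) / 4)) * e (of_int (?k i div 4) * Complex u T)) has_sum
          quarter_avg (\<lambda>w. g w * theta w) (Complex u T)) {i\<in>UNIV. 4 dvd ?k i}"
      proof (rule quarter_avg_has_sum[OF \<tau>, where c = "\<lambda>i v. ap (fst i) + ?\<delta> (fst i) v"])
        show "((\<lambda>i. (ap (fst i) + ?\<delta> (fst i) (Im w)) * e (of_int (?k i) * w)) has_sum g w * theta w) UNIV" if "w \<in> uhp" for w
          using that by (intro times_theta_has_sum[where c = "\<lambda>n. ap n + ?\<delta> n (Im w)"] g_sum(1))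
        show "ap (fst i) + ?\<delta> (fst i) (Im (Complex u T) / 4) = 0" if "?k i mod 4 = 2" for i
          using plus_space_exponent[OF that] g(4) Maass_nonhol_coeff_eq_0[OF g, of "fst i" "T / 4"] T
          by (auto simp: kohnen_plus_def)
      qed
      ultimately have "((\<lambda>(i, j). (a (fst i) * e (of_int (?k i div 4) * Complex u T))
          * ((ap (fst j) + ?\<delta> (fst j) (T / 4)) * e (of_int (?k j div 4) * Complex u T))) has_sum
         quarter_avg (\<lambda>w. f w * theta w) (Complex u T) * quarter_avg (\<lambda>w. g w * theta w) (Complex u T)) (?I \<times> ?I)"
        using has_sum_mult_Times by fastforce
      then show ?thesis
      proof (rule has_sum_cong[THEN iffD1, rotated], clarify)
        fix i j :: "int \<times> int"
        have "e (of_int (k (i, j)) * Complex u T) = e (of_int (?k i div 4) * Complex u T) * e (of_int (?k j div 4) * Complex u T)"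
          by (simp add: k_def distrib_right e_add)
        then show "(a (fst i) * e (of_int (?k i div 4) * Complex u T))
            * ((ap (fst j) + ?\<delta> (fst j) (T / 4)) * e (of_int (?k j div 4) * Complex u T))
            = c (i, j) * e (of_int (k (i, j)) * Complex u T)"
          by (simp add: c_def)
      qed
    qed
    from constant_term_has_integral[OF this]
    have "?L T = infsum c {p \<in> ?I \<times> ?I. k p = 0}" by (rule integral_unique)
    also have "{p \<in> ?I \<times> ?I. k p = 0} = ?J"
      by (auto simp: constant_term_index_def k_def)
    also have "infsum c ?J = (\<Sum>\<^sub>\<infinity>p\<in>?J. (\<lambda>(i, j). a (fst i) * ap (fst j)) p + (\<lambda>(i, j). a (fst i) * ?\<delta> (fst j) (T / 4)) p)"
      by (intro infsum_cong) (auto simp: c_def distrib_left)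
    also have "\<dots> = (\<Sum>\<^sub>\<infinity>(i, j)\<in>?J. a (fst i) * ap (fst j)) + R T"
      unfolding R_def by (rule infsum_add[OF sum_ap sum_\<delta>[OF T]])
    finally show ?thesis .
  qed
  \<comment> \<open>The absolute sum of the error terms at \<open>T = 1\<close>, from which the
    bound for larger \<open>T\<close> is scaled.\<close>
  define M where "M = (\<Sum>\<^sub>\<infinity>p\<in>?J. norm ((\<lambda>(i, j). a (fst i) * ?\<delta> (fst j) (1 / 4)) p))"
  have R_le: "norm (R T) \<le> T powr (-1/2) * M" if T: "T \<ge> 1" for T
  proof (rule norm_infsum_le)
    show "((\<lambda>(i, j). a (fst i) * ?\<delta> (fst j) (T / 4)) has_sum R T) ?J"
      unfolding R_def using sum_\<delta>[of T] T by (intro has_sum_infsum) auto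
    have "(\<lambda>p. norm ((\<lambda>(i, j). a (fst i) * ?\<delta> (fst j) (1 / 4)) p)) summable_on ?J"
      using sum_\<delta>[of 1] by (subst summable_on_iff_abs_summable_on_complex[symmetric]) simp
    then show "((\<lambda>p. T powr (-1/2) * norm ((\<lambda>(i, j). a (fst i) * ?\<delta> (fst j) (1 / 4)) p)) has_sum T powr (-1/2) * M) ?J"
      unfolding M_def by (intro has_sum_cmult_right has_sum_infsum)
    fix p assume "p \<in> ?J"
    obtain i j where p: "p = (i, j)" by (cases p)
    show "norm ((\<lambda>(i, j). a (fst i) * ?\<delta> (fst j) (T / 4)) p) \<le> T powr (-1/2) * norm ((\<lambda>(i, j). a (fst i) * ?\<delta> (fst j) (1 / 4)) p)"
      using mult_left_mono[OF norm_Maass_nonhol_coeff_le[of "1/4" T am "fst j"] norm_ge_zero[of "a (fst i)"]] T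
      by (simp add: p norm_mult mult_ac)
  qed
  have "((\<lambda>T::real. T powr (-1/2) * M) \<longlongrightarrow> 0) at_top"
    by (intro tendsto_mult_left_zero tendsto_neg_powr filterlim_ident) auto
  then have "(R \<longlongrightarrow> 0) at_top"
    by (rule Lim_null_comparison[rotated]) (use R_le in \<open>auto intro!: eventually_at_top_linorderI[of 1]\<close>)
  then have "((\<lambda>T. (\<Sum>\<^sub>\<infinity>(i, j)\<in>?J. a (fst i) * ap (fst j)) + R T) \<longlongrightarrow> (\<Sum>\<^sub>\<infinity>(i, j)\<in>?J. a (fst i) * ap (fst j)) + 0) at_top"
    by (intro tendsto_intros)
  moreover have "eventually (\<lambda>T. (\<Sum>\<^sub>\<infinity>(i, j)\<in>?J. a (fst i) * ap (fst j)) + R T = ?L T) at_top"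
    using eventually_gt_at_top[of 0] by eventually_elim (rule L[symmetric])
  ultimately have "(?L \<longlongrightarrow> (\<Sum>\<^sub>\<infinity>(i, j)\<in>?J. a (fst i) * ap (fst j)) + 0) at_top"
    by (rule Lim_transform_eventually)
  then show ?thesis
    using infsum_constant_term_index[OF sum_ap f(2)] by simp
qed


section \<open>The lift at the point i\<close>

text \<open>The two components of \<open>theta\<close> by parity, with the variable divided by 4:
  the counterpart of \<open>f_part\<close> for the unary theta function.\<close>

definition theta_part :: "int \<Rightarrow> complex \<Rightarrow> complex" where
  "theta_part h \<tau> = (\<Sum>\<^sub>\<infinity>n\<in>{n. n mod 2 = h}. e (of_int (n\<^sup>2) * (\<tau> / 4)))"

lemma theta_part_has_sum:
  assumes "\<tau> \<in> uhp"
  shows "((\<lambda>n. e (of_int (n\<^sup>2) * (\<tau> / 4))) has_sum theta_part h \<tau>) {n. n mod 2 = h}"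
proof -
  have "\<tau> / 4 \<in> uhp" using assms by (simp add: uhp_def)
  from has_sum_imp_summable[OF theta_has_sum[OF this]]
  have "(\<lambda>n. e (of_int (n\<^sup>2) * (\<tau> / 4))) summable_on {n. n mod 2 = h}"
    by (rule summable_on_subset) auto
  then show ?thesis unfolding theta_part_def by (rule has_sum_infsum)
qed

text \<open>The shift by a quarter multiplies terms with even \<open>n\<close> by 1 and terms with
  odd \<open>n\<close> by \<open>\<i>\<close> or \<open>- \<i>\<close>.\<close>

lemma theta_quarter:
  assumes \<tau>: "\<tau> \<in> uhp"
  shows "theta ((\<tau> + 1) / 4) = theta_part 0 \<tau> + \<i> * theta_part 1 \<tau>"
    and "theta ((\<tau> - 1) / 4) = theta_part 0 \<tau> - \<i> * theta_part 1 \<tau>"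
proof -
  have U: "{n::int. n mod 2 = 0} \<union> {n. n mod 2 = 1} = UNIV" "{n::int. n mod 2 = 0} \<inter> {n. n mod 2 = 1} = {}"
    by auto
  have E: "e (of_int (n\<^sup>2) / 4) = (if n mod 2 = 0 then 1 else \<i>)" for n :: int
    unfolding e_int_quarter square_mod_4 by (simp add: even_iff_mod_2_eq_zero)
  have E': "e (- of_int (n\<^sup>2) / 4) = (if n mod 2 = 0 then 1 else - \<i>)" for n :: int
    using E[of n] e_minus[of "of_int (n\<^sup>2) / 4"] by auto
  have s0: "((\<lambda>n. e (of_int (n\<^sup>2) * ((\<tau> + 1) / 4))) has_sum theta_part 0 \<tau>) {n. n mod 2 = 0}"
    by (rule has_sum_cong[THEN iffD1, OF _ theta_part_has_sum[OF \<tau>]], unfold e_quarter_shift E, simp)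
  have s0': "((\<lambda>n. e (of_int (n\<^sup>2) * ((\<tau> - 1) / 4))) has_sum theta_part 0 \<tau>) {n. n mod 2 = 0}"
    by (rule has_sum_cong[THEN iffD1, OF _ theta_part_has_sum[OF \<tau>]], unfold e_quarter_shift E', simp)
  have s1: "((\<lambda>n. e (of_int (n\<^sup>2) * ((\<tau> + 1) / 4))) has_sum \<i> * theta_part 1 \<tau>) {n. n mod 2 = 1}"
    by (rule has_sum_cong[THEN iffD1, OF _ has_sum_cmult_right[OF theta_part_has_sum[OF \<tau>]]],
        unfold e_quarter_shift E, simp)
  have s1': "((\<lambda>n. e (of_int (n\<^sup>2) * ((\<tau> - 1) / 4))) has_sum - \<i> * theta_part 1 \<tau>) {n. n mod 2 = 1}"
    by (rule has_sum_cong[THEN iffD1, OF _ has_sum_cmult_right[OF theta_part_has_sum[OF \<tau>]]],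
        unfold e_quarter_shift E', simp)
  from has_sum_Un_disjoint[OF s0 s1 U(2)] theta_has_sum[OF quarter_shift_in_uhp(1)[OF \<tau>]]
  show "theta ((\<tau> + 1) / 4) = theta_part 0 \<tau> + \<i> * theta_part 1 \<tau>"
    unfolding U(1) by (rule has_sum_unique[symmetric])
  from has_sum_Un_disjoint[OF s0' s1' U(2)] theta_has_sum[OF quarter_shift_in_uhp(2)[OF \<tau>]]
  have "theta_part 0 \<tau> + - \<i> * theta_part 1 \<tau> = theta ((\<tau> - 1) / 4)"
    unfolding U(1) by (rule has_sum_unique)
  then show "theta ((\<tau> - 1) / 4) = theta_part 0 \<tau> - \<i> * theta_part 1 \<tau>" by simp
qed

text \<open>By the plus condition only exponents 0 and 3 modulo 4 occur; on the latter the shift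
  gives the factor \<open>- \<i>\<close> or \<open>\<i>\<close>, opposite to the one for
  \<open>theta\<close>.\<close>

lemma f_part_quarter:
  assumes f: "q_expansion f a" "kohnen_plus a" and \<tau>: "\<tau> \<in> uhp"
  shows "f ((\<tau> + 1) / 4) = f_part f 0 \<tau> - \<i> * f_part f 3 \<tau>"
    and "f ((\<tau> - 1) / 4) = f_part f 0 \<tau> + \<i> * f_part f 3 \<tau>"
proof -
  let ?A = "{n::int. n mod 4 = 0}" and ?B = "{n::int. n mod 4 = 3}"
  have f_sum: "((\<lambda>n. a n * e (of_int n * w)) has_sum f w) UNIV" if "w \<in> uhp" for w
    using f(1) that by (simp add: q_expansion_def)
  have AB: "?A \<inter> ?B = {}" by auto
  have part: "((\<lambda>n. a n * e (of_int n * (\<tau> / 4))) has_sum f_part f r \<tau>) {n. n mod 4 = r}" for r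
  proof -
    have "\<tau> / 4 \<in> uhp" using \<tau> by (simp add: uhp_def)
    from has_sum_imp_summable[OF f_sum[OF this]]
    have "(\<lambda>n. a n * e (of_int n * (\<tau> / 4))) summable_on {n. n mod 4 = r}"
      by (rule summable_on_subset) auto
    then show ?thesis unfolding f_part_def q_coeff_eq[OF f(1)] times_divide_eq_left times_divide_eq_right
      by (rule has_sum_infsum)
  qed
  have E: "e (of_int n / 4) = (if n mod 4 = 0 then 1 else - \<i>)" "e (- (of_int n / 4)) = (if n mod 4 = 0 then 1 else \<i>)"
    if "n mod 4 \<in> {0, 3}" for n :: int
    using that e_int_quarter[of n] e_minus[of "of_int n / 4"] by auto
  have s0: "((\<lambda>n. a n * e (of_int n * ((\<tau> + 1) / 4))) has_sum f_part f 0 \<tau>) ?A"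
    by (rule has_sum_cong[THEN iffD1, OF _ part], unfold e_quarter_shift, simp add: E)
  have s0': "((\<lambda>n. a n * e (of_int n * ((\<tau> - 1) / 4))) has_sum f_part f 0 \<tau>) ?A"
    by (rule has_sum_cong[THEN iffD1, OF _ part], unfold e_quarter_shift, simp add: E)
  have s1: "((\<lambda>n. a n * e (of_int n * ((\<tau> + 1) / 4))) has_sum - \<i> * f_part f 3 \<tau>) ?B"
    by (rule has_sum_cong[THEN iffD1, OF _ has_sum_cmult_right[OF part]], unfold e_quarter_shift, simp add: E)
  have s1': "((\<lambda>n. a n * e (of_int n * ((\<tau> - 1) / 4))) has_sum \<i> * f_part f 3 \<tau>) ?B"
    by (rule has_sum_cong[THEN iffD1, OF _ has_sum_cmult_right[OF part]], unfold e_quarter_shift, simp add: E)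
  have supp: "((\<lambda>n. a n * e (of_int n * w)) has_sum f w) (?A \<union> ?B)" if "w \<in> uhp" for w
  proof (rule has_sum_cong_neutral[THEN iffD1, OF _ _ _ f_sum[OF that]])
    fix n :: int assume "n \<in> UNIV - (?A \<union> ?B)"
    then have "n mod 4 \<in> {1, 2}" using pos_mod_bound[of 4 n] pos_mod_sign[of 4 n] by auto
    then show "a n * e (of_int n * w) = 0" using f(2) by (auto simp: kohnen_plus_def)
  qed auto
  from has_sum_unique[OF supp[OF quarter_shift_in_uhp(1)[OF \<tau>]] has_sum_Un_disjoint[OF s0 s1 AB]]
  show "f ((\<tau> + 1) / 4) = f_part f 0 \<tau> - \<i> * f_part f 3 \<tau>" by simp
  from has_sum_unique[OF supp[OF quarter_shift_in_uhp(2)[OF \<tau>]] has_sum_Un_disjoint[OF s0' s1' AB]]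
  show "f ((\<tau> - 1) / 4) = f_part f 0 \<tau> + \<i> * f_part f 3 \<tau>" by simp
qed

text \<open>Averaging cancels the mixed products, which enter with opposite signs, and the opposite
  factors \<open>\<i>\<close> and \<open>- \<i>\<close> multiply to 1.\<close>

lemma quarter_avg_f_theta:
  assumes "q_expansion f a" "kohnen_plus a" "\<tau> \<in> uhp"
  shows "quarter_avg (\<lambda>w. f w * theta w) \<tau> = f_part f 0 \<tau> * theta_part 0 \<tau> + f_part f 3 \<tau> * theta_part 1 \<tau>"
  unfolding quarter_avg_def f_part_quarter[OF assms] theta_quarter[OF assms(3)]
  by (simp add: field_simps)

lemma quarter_avg_norm_theta:
  assumes "\<tau> \<in> uhp"
  shows "quarter_avg (\<lambda>w. theta w * cnj (theta w)) \<tau>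
     = theta_part 0 \<tau> * cnj (theta_part 0 \<tau>) + theta_part 1 \<tau> * cnj (theta_part 1 \<tau>)"
  unfolding quarter_avg_def theta_quarter[OF assms] by (simp add: field_simps)

text \<open>At \<open>z = i\<close> the form \<open>Q\<close> splits: with \<open>n = a + c\<close> and \<open>m = c - a\<close>, which have the same
  parity, \<open>Q_pos\<close> is \<open>n\<^sup>2/4\<close> and \<open>Q_neg\<close> is \<open>-(m\<^sup>2 + b\<^sup>2)/4\<close>.\<close>

lemma cnj_Theta_i:
  assumes \<tau>: "\<tau> \<in> uhp" and h: "h \<in> {0, 1}"
  shows "cnj (Theta h \<tau> \<i>) = of_real (Im \<tau>) *
     (theta_part 0 \<tau> * cnj (theta_part 0 \<tau>) + theta_part 1 \<tau> * cnj (theta_part 1 \<tau>)) * theta_part h \<tau>"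
proof -
  let ?E = "\<lambda>n::int. e (of_int (n\<^sup>2) * (\<tau> / 4))"
  let ?A = "\<lambda>h. {n::int. n mod 2 = h}"
  define P where "P = {(m::int, n::int). m mod 2 = n mod 2}"
  define N where "N = theta_part 0 \<tau> * cnj (theta_part 0 \<tau>) + theta_part 1 \<tau> * cnj (theta_part 1 \<tau>)"
  have "((\<lambda>(m, n). ?E m * cnj (?E n)) has_sum theta_part h \<tau> * cnj (theta_part h \<tau>)) (?A h \<times> ?A h)" for h
    by (intro has_sum_mult_Times theta_part_has_sum \<tau>) (simp only: has_sum_cnj_iff theta_part_has_sum \<tau>)
  moreover have "(?A 0 \<times> ?A 0) \<inter> (?A 1 \<times> ?A 1) = {}" by auto
  ultimately have "((\<lambda>(m, n). ?E m * cnj (?E n)) has_sum N) (?A 0 \<times> ?A 0 \<union> ?A 1 \<times> ?A 1)"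
    unfolding N_def by (intro has_sum_Un_disjoint)
  also have "?A 0 \<times> ?A 0 \<union> ?A 1 \<times> ?A 1 = P" by (auto simp: P_def)
  \<comment> \<open>After conjugation \<open>m\<close> and \<open>b\<close> carry \<tau> while
    \<open>n\<close> carries its conjugate. Parity ties \<open>m\<close> to \<open>n\<close> only,
    and \<open>b\<close> is restricted by \<open>h\<close> alone, so the sum factors.\<close>
  finally have "((\<lambda>(p, b). (case p of (m, n) \<Rightarrow> ?E m * cnj (?E n)) * ?E b) has_sum N * theta_part h \<tau>) (P \<times> ?A h)"
    by (rule has_sum_mult_Times[OF _ theta_part_has_sum[OF \<tau>]])
  also have "?this \<longleftrightarrow> ((\<lambda>l. cnj (e (of_real (Q_pos \<i> l) * \<tau> + of_real (Q_neg \<i> l) * cnj \<tau>))) has_sum N * theta_part h \<tau>)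
      {(a, b, c). b mod 2 = h mod 2}"
  \<comment> \<open>Halving is exact because \<open>m\<close> and \<open>n\<close> have the same
    parity.\<close>
  proof (rule has_sum_reindex_bij_witness[where i = "\<lambda>(a, b, c). ((c - a, a + c), b)" and j = "\<lambda>((m, n), b). ((n - m) div 2, b, (m + n) div 2)"], goal_cases)
    case (1 p)
    then obtain m n b where p: "p = ((m, n), b)" "m mod 2 = n mod 2" by (auto simp: P_def)
    then show ?case by simp presburger
  next
    case (2 p)
    then show ?case using h by auto
  next
    case (3 l)
    then show ?case by auto
  next
    case (4 l)
    then show ?case using h by (auto simp: P_def) presburger+
  next
    case (5 p)
    then obtain m n b where p: "p = ((m, n), b)" "m mod 2 = n mod 2" by (auto simp: P_def)
    define a c where "a = (n - m) div 2" and "c = (m + n) div 2"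
    have n: "n = a + c" and m: "m = c - a" using p(2) unfolding a_def c_def by presburger+
    have "of_real (Q_pos \<i> (a, b, c)) * \<tau> + of_real (Q_neg \<i> (a, b, c)) * cnj \<tau>
        = of_int (n\<^sup>2) * (\<tau> / 4) - of_int (m\<^sup>2) * (cnj \<tau> / 4) - of_int (b\<^sup>2) * (cnj \<tau> / 4)"
    proof -
      have Q: "Q_pos \<i> (a, b, c) = of_int (n\<^sup>2) / 4" by (simp add: Q_pos_def n)
      have Q': "Q_neg \<i> (a, b, c) = - (of_int (m\<^sup>2) + of_int (b\<^sup>2)) / 4"
        by (simp add: Q_neg_def m cmod_power2)
      show ?thesis unfolding Q Q' by (simp add: field_simps)
    qed
    note eq = this
    have "cnj (e (of_real (Q_pos \<i> (a, b, c)) * \<tau> + of_real (Q_neg \<i> (a, b, c)) * cnj \<tau>))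
       = e (of_int (m\<^sup>2) * (\<tau> / 4) + of_int (n\<^sup>2) * (- cnj (\<tau> / 4)) + of_int (b\<^sup>2) * (\<tau> / 4))"
      unfolding cnj_e eq by (intro arg_cong[where f = e]) (simp add: algebra_simps)
    also have "\<dots> = ?E m * cnj (?E n) * ?E b"
      by (simp only: e_add cnj_e complex_cnj_mult complex_cnj_of_int mult_minus_right)
    finally show ?case by (simp add: p a_def c_def)
  qed simp
  finally have "(\<Sum>\<^sub>\<infinity>l\<in>{(a, b, c). b mod 2 = h mod 2}. cnj (e (of_real (Q_pos \<i> l) * \<tau> + of_real (Q_neg \<i> l) * cnj \<tau>)))
      = N * theta_part h \<tau>"
    by (rule infsumI)
  then show ?thesis by (simp add: Theta_def N_def mult.assoc)
qed

text \<open>The constant arises as follows: the averages contribute 1/4 from the inner derivative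
  and 8 from \<open>(Im \<tau> / 4) powr (-3/2)\<close>, so \<open>Hu + \<i> * Hv\<close> is
  \<open>2 * \<i>\<close> times the integrand of the lift, while Green's theorem returns
  \<open>\<i>\<close> times the integral over the top edge.\<close>

lemma truncated_lift_i:
  assumes f: "q_expansion f a" "kohnen_plus a" "f holomorphic_on uhp" "modular_Gamma0_4 (-1) f"
    and g: "smooth_uhp g" "\<forall>\<tau>\<in>uhp. xi (3/2) g \<tau> = theta \<tau>" "Maass_expansion g ap am" "kohnen_plus ap"
      "modular_Gamma0_4 3 g"
    and T: "T \<ge> 1"
  shows "truncated_lift f \<i> T = 1/2 * integral {-1/2..1/2} (\<lambda>u. quarter_avg (\<lambda>w. f w * theta w) (Complex u T)
                 * quarter_avg (\<lambda>w. g w * theta w) (Complex u T))"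
proof -
  define p1 where "p1 = (\<lambda>w. f w * theta w)"
  define p2 where "p2 = (\<lambda>w. g w * theta w)"
  define H where "H = (\<lambda>\<tau>. quarter_avg p1 \<tau> * quarter_avg p2 \<tau>)"
  define pu where "pu = (\<lambda>w. g w * deriv theta w + d_u g w * theta w)"
  define pv where "pv = (\<lambda>w. g w * (\<i> * deriv theta w) + d_v g w * theta w)"
  define Hu where "Hu = (\<lambda>\<tau>. quarter_avg p1 \<tau> * (quarter_avg pu \<tau> / 4) + quarter_avg (deriv p1) \<tau> / 4 * quarter_avg p2 \<tau>)"
  define Hv where "Hv = (\<lambda>\<tau>. quarter_avg p1 \<tau> * (quarter_avg pv \<tau> / 4) + quarter_avg (\<lambda>w. \<i> * deriv p1 w) \<tau> / 4 * quarter_avg p2 \<tau>)"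
  have g_diff: "g differentiable_on uhp"
    using g(1)[unfolded smooth_uhp_def, rule_format, of 0 0] by simp
  have p1_sum: "((\<lambda>i. a (fst i) * e (of_int (fst i + (snd i)\<^sup>2) * w)) has_sum p1 w) UNIV" if "w \<in> uhp" for w
    using f(1) that unfolding p1_def by (intro times_theta_has_sum) (auto simp: q_expansion_def)
  have p2_sum: "((\<lambda>i. (ap (fst i) + Maass_nonhol_coeff am (fst i) (Im w)) * e (of_int (fst i + (snd i)\<^sup>2) * w)) has_sum p2 w) UNIV"
    if "w \<in> uhp" for w
    unfolding p2_def using that
    by (intro times_theta_has_sum[where c = "\<lambda>n. ap n + Maass_nonhol_coeff am n (Im w)"] Maass_expansion_has_sum(1)[OF g(3)])
  have per1: "quarter_avg p1 (\<tau> + 1) = quarter_avg p1 \<tau>" if "\<tau> \<in> uhp" for \<tau>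
  proof (rule quarter_avg_periodic[OF that, where c = "\<lambda>i v. a (fst i)"])
    show "a (fst i) = 0" if "(fst i + (snd i)\<^sup>2) mod 4 = 2" for i
      using plus_space_exponent[OF that] f(2) by (auto simp: kohnen_plus_def)
  qed (rule p1_sum)
  have per2: "quarter_avg p2 (\<tau> + 1) = quarter_avg p2 \<tau>" if "\<tau> \<in> uhp" for \<tau>
  proof (rule quarter_avg_periodic[OF that, where c = "\<lambda>i v. ap (fst i) + Maass_nonhol_coeff am (fst i) v"])
    show "ap (fst i) + Maass_nonhol_coeff am (fst i) v = 0" if "(fst i + (snd i)\<^sup>2) mod 4 = 2" "v > 0" for i v
      using plus_space_exponent[OF that(1)] g(4) Maass_nonhol_coeff_eq_0[OF g(1-4) _ that(2)]
      by (auto simp: kohnen_plus_def)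
  qed (rule p2_sum)
  have inv1: "quarter_avg p1 (- 1 / \<tau>) = quarter_avg p1 \<tau>" if "\<tau> \<in> uhp" for \<tau>
    using quarter_avg_inversion[OF that, of 0 p1]
      theta_product_weight_0[OF f(4) holomorphic_on_imp_continuous_on[OF f(3)]] by (simp add: p1_def)
  have inv2: "quarter_avg p2 (- 1 / \<tau>) = \<tau>\<^sup>2 * quarter_avg p2 \<tau>" if "\<tau> \<in> uhp" for \<tau>
    using quarter_avg_inversion[OF that, of 2 p2] theta_product_weight_2[OF g(5) g_diff g(2)]
    by (simp add: p2_def)
  have "p1 holomorphic_on uhp"
    unfolding p1_def by (intro holomorphic_intros f(3) theta_holomorphic)
  from partials_quarter_avg[OF partials_holomorphic[OF this]]
  have "partials_on_uhp (quarter_avg p1) (\<lambda>\<tau>. quarter_avg (deriv p1) \<tau> / 4) (\<lambda>\<tau>. quarter_avg (\<lambda>w. \<i> * deriv p1 w) \<tau> / 4)" .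
  moreover have "partials_on_uhp p2 pu pv"
    unfolding p2_def pu_def pv_def
    by (intro partials_mult partials_smooth g(1) partials_holomorphic theta_holomorphic)
  from partials_quarter_avg[OF this]
  have "partials_on_uhp (quarter_avg p2) (\<lambda>\<tau>. quarter_avg pu \<tau> / 4) (\<lambda>\<tau>. quarter_avg pv \<tau> / 4)" .
  ultimately have H: "partials_on_uhp H Hu Hv"
    unfolding H_def Hu_def Hv_def by (rule partials_mult)
  have green: "(LINT \<tau>:truncated_fundamental_domain T|lborel. Hu \<tau> + \<i> * Hv \<tau>)
      = \<i> * integral {-1/2..1/2} (\<lambda>u. H (Complex u T))"
    using H per1 per2 inv1 inv2 T
    by (intro green_truncated_fundamental_domain) (auto simp: partials_on_uhp_def H_def)
  have integrand: "(f_part f 0 \<tau> * cnj (Theta 0 \<tau> \<i>) + f_part f 3 \<tau> * cnj (Theta 1 \<tau> \<i>))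
        * of_real (Im \<tau> powr (-1/2) / (Im \<tau>)\<^sup>2) = 1 / (2 * \<i>) * (Hu \<tau> + \<i> * Hv \<tau>)" if \<tau>: "\<tau> \<in> uhp" for \<tau>
  proof -
    have v: "Im \<tau> > 0" using \<tau> by (simp add: uhp_def)
    define N where "N = quarter_avg (\<lambda>w. theta w * cnj (theta w)) \<tau>"
    \<comment> \<open>The leading factor \<open>Im \<tau>\<close> is the one in front of the kernel
      \<open>Theta\<close>.\<close>
    have pw: "Im \<tau> * (Im \<tau> powr (-1/2) / (Im \<tau>)\<^sup>2) = Im \<tau> powr (-3/2)"
    proof -
      have "Im \<tau> powr (-3/2) * Im \<tau> = Im \<tau> powr (-1/2)"
        using v powr_add[of "Im \<tau>" "-3/2" 1] by simp
      then show ?thesis using v by (simp add: field_simps power2_eq_square)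
    qed
    have four: "(Im \<tau> / 4) powr (-3/2) = 8 * Im \<tau> powr (-3/2)"
    proof -
      have q: "(4::real) powr (-3/2) = 1 / 8"
        using powr_powr[of 2 2 "-3/2 :: real"] powr_minus[of 2 "3::real"] by simp
      have d: "(Im \<tau> / 4) powr (-3/2) = Im \<tau> powr (-3/2) / 4 powr (-3/2)"
        using v by (simp add: powr_divide)
      show ?thesis unfolding d q by simp
    qed
    have pp: "pu w + \<i> * pv w = \<i> * of_real (Im w powr (-3/2)) * (theta w * cnj (theta w))" if "w \<in> uhp" for w
    proof -
      have "pu w + \<i> * pv w = theta w * (d_u g w + \<i> * d_v g w)"
        by (simp add: pu_def pv_def algebra_simps)
      then show ?thesis using d_taubar_of_xi_theta[of g w] g(2) that by simp
    qed
    have "quarter_avg pu \<tau> + \<i> * quarter_avg pv \<tau>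
        = ((pu ((\<tau> + 1) / 4) + \<i> * pv ((\<tau> + 1) / 4)) + (pu ((\<tau> - 1) / 4) + \<i> * pv ((\<tau> - 1) / 4))) / 2"
      by (simp add: quarter_avg_def field_simps)
    also have "\<dots> = \<i> * of_real ((Im \<tau> / 4) powr (-3/2)) * N"
      unfolding pp[OF quarter_shift_in_uhp(1)[OF \<tau>]] pp[OF quarter_shift_in_uhp(2)[OF \<tau>]]
      by (simp add: N_def quarter_avg_def field_simps)
    finally have G: "quarter_avg pu \<tau> + \<i> * quarter_avg pv \<tau> = 8 * \<i> * of_real (Im \<tau> powr (-3/2)) * N"
      unfolding four by simp
    \<comment> \<open>The Cauchy-Riemann equation for the holomorphic factor, so that only
      \<open>g\<close> contributes to the \<tau>-bar derivative of \<open>H\<close>.\<close>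
    have z: "quarter_avg (deriv p1) \<tau> + \<i> * quarter_avg (\<lambda>w. \<i> * deriv p1 w) \<tau> = 0"
      by (simp add: quarter_avg_def field_simps)
    have "Hu \<tau> + \<i> * Hv \<tau> = quarter_avg p1 \<tau> * (quarter_avg pu \<tau> + \<i> * quarter_avg pv \<tau>) / 4
        + (quarter_avg (deriv p1) \<tau> + \<i> * quarter_avg (\<lambda>w. \<i> * deriv p1 w) \<tau>) / 4 * quarter_avg p2 \<tau>"
      by (simp add: Hu_def Hv_def algebra_simps add_divide_distrib)
    also have "\<dots> = 2 * \<i> * (quarter_avg p1 \<tau> * of_real (Im \<tau> powr (-3/2)) * N)"
      unfolding G z by simp
    finally have R: "1 / (2 * \<i>) * (Hu \<tau> + \<i> * Hv \<tau>) = quarter_avg p1 \<tau> * of_real (Im \<tau> powr (-3/2)) * N"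
      by simp
    have "(f_part f 0 \<tau> * cnj (Theta 0 \<tau> \<i>) + f_part f 3 \<tau> * cnj (Theta 1 \<tau> \<i>))
        = of_real (Im \<tau>) * N * quarter_avg p1 \<tau>"
      unfolding p1_def N_def quarter_avg_f_theta[OF f(1,2) \<tau>] quarter_avg_norm_theta[OF \<tau>]
      by (simp add: cnj_Theta_i[OF \<tau>] algebra_simps)
    then have "(f_part f 0 \<tau> * cnj (Theta 0 \<tau> \<i>) + f_part f 3 \<tau> * cnj (Theta 1 \<tau> \<i>))
        * of_real (Im \<tau> powr (-1/2) / (Im \<tau>)\<^sup>2)
        = of_real (Im \<tau> * (Im \<tau> powr (-1/2) / (Im \<tau>)\<^sup>2)) * N * quarter_avg p1 \<tau>"
      by simp
    then show ?thesis unfolding pw R by (simp add: mult_ac)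
  qed
  have scale: "(LINT \<tau>:A|lborel. c * k \<tau>) = c * (LINT \<tau>:A|lborel. k \<tau>)"
    for A c and k :: "complex \<Rightarrow> complex"
    by (simp add: set_lebesgue_integral_def mult_scaleR_right[symmetric] del: mult_scaleR_right)
  have "truncated_lift f \<i> T = (LINT \<tau>:truncated_fundamental_domain T|lborel. 1 / (2 * \<i>) * (Hu \<tau> + \<i> * Hv \<tau>))"
    unfolding truncated_lift_def
  proof (rule set_lebesgue_integral_cong)
    show "truncated_fundamental_domain T \<in> sets lborel"
      using compact_truncated_fundamental_domain[of T] by (simp add: borel_compact)
  qed (use integrand in \<open>auto simp: truncated_fundamental_domain_def\<close>)
  also have "\<dots> = 1 / (2 * \<i>) * (LINT \<tau>:truncated_fundamental_domain T|lborel. Hu \<tau> + \<i> * Hv \<tau>)"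
    by (rule scale)
  also have "\<dots> = 1 / 2 * integral {-1/2..1/2} (\<lambda>u. H (Complex u T))"
    unfolding green by simp
  finally show ?thesis by (simp add: H_def p1_def p2_def)
qed

text \<open>Convergence is asserted together with the value, because \<open>Lim\<close> in
  \<open>Phi\<close> denotes the regularized integral only when the limit exists.\<close>

theorem theorem1p4:
  fixes D :: int
    and f_D theta_tilde :: "complex \<Rightarrow> complex"
    and ap am :: "int \<Rightarrow> complex"
  assumes "D > 0" and "D mod 4 \<in> {0, 1}"
    and "f_D \<in> M_shriek_minus_half"
    and "\<forall>n<0. q_coeff f_D n = (if n = - D then 1 else 0)"
    and "harmonic_Maass_form 3 theta_tilde"
    and "\<forall>\<tau>\<in>uhp. xi (3/2) theta_tilde \<tau> = theta \<tau>"
    and "Maass_expansion theta_tilde ap am"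
    and "kohnen_plus ap"
  shows "(truncated_lift f_D \<i> \<longlongrightarrow> Phi f_D \<i>) at_top \<and>
    Phi f_D \<i> =
      1/2 * (\<Sum>\<^sub>\<infinity>d::int. q_coeff f_D (- d) *
               (\<Sum>\<^sub>\<infinity>(x, y)\<in>{(x::int, y::int). x mod 2 = d mod 2}. ap (d - x\<^sup>2 - y\<^sup>2)))"
proof -
  obtain a where a: "q_expansion f_D a" "kohnen_plus a"
    and f: "f_D holomorphic_on uhp" "modular_Gamma0_4 (-1) f_D"
    using assms(3) by (auto simp: M_shriek_minus_half_def weakly_holomorphic_def)
  have g: "smooth_uhp theta_tilde" "modular_Gamma0_4 3 theta_tilde"
    using assms(5) by (auto simp: harmonic_Maass_form_def)
  let ?S = "1/2 * (\<Sum>\<^sub>\<infinity>d::int. q_coeff f_D (- d) *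
               (\<Sum>\<^sub>\<infinity>(x, y)\<in>{(x::int, y::int). x mod 2 = d mod 2}. ap (d - x\<^sup>2 - y\<^sup>2)))"
  have "((\<lambda>T. 1/2 * integral {-1/2..1/2} (\<lambda>u. quarter_avg (\<lambda>w. f_D w * theta w) (Complex u T)
                 * quarter_avg (\<lambda>w. theta_tilde w * theta w) (Complex u T))) \<longlongrightarrow> ?S) at_top"
    unfolding q_coeff_eq[OF a(1)]
    by (intro tendsto_mult_left constant_term_limit[OF a g(1) assms(6-8)])
  \<comment> \<open>The formula for the truncated lift is available for \<open>T \<ge> 1\<close>,
    which determines the limit at infinity.\<close>
  moreover have "eventually (\<lambda>T. 1/2 * integral {-1/2..1/2} (\<lambda>u. quarter_avg (\<lambda>w. f_D w * theta w) (Complex u T)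
                 * quarter_avg (\<lambda>w. theta_tilde w * theta w) (Complex u T)) = truncated_lift f_D \<i> T) at_top"
    using eventually_ge_at_top[of 1]
    by eventually_elim (rule truncated_lift_i[symmetric, OF a f g(1) assms(6-8) g(2)])
  ultimately have lim: "(truncated_lift f_D \<i> \<longlongrightarrow> ?S) at_top"
    by (rule Lim_transform_eventually)
  then have Phi: "Phi f_D \<i> = ?S"
    unfolding Phi_def by (intro tendsto_Lim) auto
  show ?thesis unfolding Phi using lim by (intro conjI refl)
qed

end
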